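(* Let $p$ be an odd prime. (i) We have $$\sum_{k=0}^{(p-3)/2}\frac{\binom{2k}{k}}{(2k+1)4^k}\equiv(-1)^{(p+1)/2}q_p(2)\pmod{p^2},$$ and $$\sum_{p/2<k<p}\frac{\binom{2k}{k}}{(2k+1)4^k}\equiv pE_{p-3}\pmod{p^2},$$ which is equivalent to the (also valid) congruence $$\sum_{k=1}^{(p-1)/2}\frac{4^k}{(2k-1)\binom{2k}{k}}\equiv E_{p-3}+(-1)^{(p-1)/2}-1\pmod p.$$ (ii) Suppose $p>3$. Then $$\sum_{k=0}^{(p-3)/2}\frac{\binom{2k}{k}}{(2k+1)16^k}\equiv0\pmod{p^2},$$ and $$\sum_{p/2<k<p}\frac{\binom{2k}{k}}{(2k+1)16^k}\equiv\frac p3E_{p-3}\pmod{p^2},$$ which is equivalent to the (also valid) congruence $$\sum_{k=1}^{(p-1)/2}\frac{16^k}{k(2k-1)\binom{2k}{k}}\equiv\frac83E_{p-3}\pmod p.$$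
   Context: Congruences modulo $p^m$ are between rational numbers whose denominators are prime to $p$: $a\equiv b\pmod{p^m}$ means that $a-b$ is $p^m$ times a rational number with denominator prime to $p$. For a prime $p$ and an integer $a\not\equiv0\pmod p$, $q_p(a)=(a^{p-1}-1)/p$ is the Fermat quotient. The Euler numbers $E_0,E_1,E_2,\ldots$ are the integers defined by $E_0=1$ and $\sum_{0\le k\le n,\ 2\mid k}\binom nkE_{n-k}=0$ for $n=1,2,3,\ldots$. *)

theory Defs
  imports Complex_Main "HOL-Computational_Algebra.Primes"
begin

definition p_integral :: "nat \<Rightarrow> rat \<Rightarrow> bool" where
  "p_integral p r \<longleftrightarrow> coprime (snd (quotient_of r)) (int p)"

text \<open>
  The congruence \<open>a \<equiv> b\<close> modulo \<open>p ^ m\<close>. It relates only rational numbers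
  whose denominators are prime to \<open>p\<close>, so it is false if \<open>p\<close> divides the denominator
  of \<open>a\<close> or \<open>b\<close>.
\<close>
definition rat_cong :: "nat \<Rightarrow> nat \<Rightarrow> rat \<Rightarrow> rat \<Rightarrow> bool" where
  "rat_cong p m a b \<longleftrightarrow>
     p_integral p a \<and> p_integral p b \<and>
     (\<exists>r. p_integral p r \<and> a - b = of_nat p ^ m * r)"

text \<open>The division is in the rationals; the value is an integer when \<open>p\<close> is a prime
  not dividing \<open>a\<close>.\<close>
definition fermat_quotient :: "nat \<Rightarrow> int \<Rightarrow> rat" where
  "fermat_quotient p a = (of_int a ^ (p - 1) - 1) / of_nat p"

text \<open>The \<open>k = 0\<close> term of the recurrence is \<open>E n\<close>, so the recurrence is solved for it.\<close>
fun euler_number :: "nat \<Rightarrow> int" where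
  "euler_number n =
     (if n = 0 then 1
      else - (\<Sum>k\<in>{k\<in>{1..n}. even k}. int (n choose k) * euler_number (n - k)))"

declare euler_number.simps [simp del]

lemma euler_number_0: "euler_number 0 = 1"
  by (simp add: euler_number.simps)

lemma euler_number_recurrence:
  assumes "n \<ge> 1"
  shows "(\<Sum>k\<in>{k\<in>{0..n}. even k}. int (n choose k) * euler_number (n - k)) = 0"
proof -
  have "{k\<in>{0..n}. even k} = insert 0 {k\<in>{1..n}. even k}"
    by (auto simp: Suc_le_eq)
  moreover have "finite {k\<in>{1..n}. even k}"
    by (rule finite_subset[of _ "{1..n}"]) auto
  ultimately show ?thesis
    using assms euler_number.simps[of n] by (simp add: sum.insert)
qed

end

theory Submission
  imports Defs "HOL-Number_Theory.Residues" "HOL-Computational_Algebra.Polynomial"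
begin

text \<open>
  Let \<open>p = 2 n + 1\<close>. Modulo \<open>p ^ 2\<close> one has \<open>(2k choose k) / (-16) ^ k \<equiv> (n + k choose 2k)\<close>
  for \<open>k \<le> n\<close>. The polynomial with coefficients \<open>(n + k choose 2k)\<close> is
  \<open>cos ((2 n + 1) t) / cos t\<close> at \<open>- 4 sin\<^sup>2 t\<close>, so it can be integrated exactly; this gives
  the two sums over \<open>k < n\<close>.

  The terms with \<open>k > n\<close>, and likewise those of the sums with inverse binomial coefficients, reduce
  to \<open>T y = (\<Sum>k=1..n. y ^ k / (k ^ 2 * (2k choose k)))\<close> modulo \<open>p\<close> with \<open>y = 4\<close> and \<open>y = 1\<close>.
  If \<open>y = 2 - u - 1 / u\<close>, then \<open>T y \<equiv> (\<Sum>i=1..n. (u ^ i + u ^ (-i)) / i ^ 2)\<close>: expanding the right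
  side in powers of \<open>y\<close>, each coefficient is a sum over \<open>i\<close> of an even polynomial of degree less
  than \<open>p - 1\<close>, and such a polynomial sums to zero over all residues. For \<open>u = -1\<close> the right
  side is twice \<open>S = (\<Sum>i=1..n. (-1) ^ i / i ^ 2)\<close>, which is an alternating sum of powers
  \<open>i ^ (p - 3)\<close> and hence given by an Euler number. For \<open>u\<close> a primitive sixth root of unity,
  multiplying the summation index by \<open>3\<close> modulo \<open>p\<close> relates it to \<open>S\<close>.
\<close>

section \<open>Congruences between rational numbers\<close>

text \<open>The reduced denominator divides the denominator of every representation, so one
  representation with denominator prime to \<open>p\<close> is enough. Closure under sums and
  products can then be read off from unreduced fractions.\<close>

lemma p_integral_iff:
  assumes "prime p"
  shows "p_integral p r \<longleftrightarrow> (\<exists>a b. \<not> int p dvd b \<and> r = of_int a / of_int b)"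
proof -
  obtain c d where cd: "quotient_of r = (c, d)" by fastforce
  note facts = quotient_of_div[OF cd] quotient_of_denom_pos[OF cd] quotient_of_coprime[OF cd]
  have prime_int: "prime (int p)" using assms by simp
  show ?thesis
  proof
    assume "p_integral p r"
    hence "coprime (int p) d" by (simp add: p_integral_def cd coprime_commute)
    hence "\<not> int p dvd d"
      using prime_int by (meson coprime_absorb_left not_prime_unit)
    thus "\<exists>a b. \<not> int p dvd b \<and> r = of_int a / of_int b" using facts by auto
  next
    assume "\<exists>a b. \<not> int p dvd b \<and> r = of_int a / of_int b"
    then obtain a b where ab: "\<not> int p dvd b" "r = of_int a / of_int b" by blast
    have "b \<noteq> 0" using ab by auto
    hence "(of_int (a * d) :: rat) = of_int (c * b)" using facts ab by (simp add: field_simps)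
    hence "a * d = c * b" by (simp only: of_int_eq_iff)
    hence "d dvd c * b" by (metis dvd_triv_right)
    hence "d dvd b" using facts(3) by (simp add: coprime_commute coprime_dvd_mult_right_iff)
    hence "\<not> int p dvd d" using ab by (meson dvd_trans)
    hence "coprime (int p) d" using prime_int prime_imp_coprime by blast
    thus "p_integral p r" by (simp add: p_integral_def cd coprime_commute)
  qed
qed

locale rat_cong_prime =
  fixes p :: nat
  assumes prime: "prime p"
begin

abbreviation integral :: "rat \<Rightarrow> bool" where
  "integral \<equiv> p_integral p"

abbreviation cong1 :: "rat \<Rightarrow> rat \<Rightarrow> bool"  (infix "\<approx>" 50) where
  "a \<approx> b \<equiv> rat_cong p (Suc 0) a b"

lemma p_pos [simp]: "p > 0" using prime prime_gt_0_nat by blast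

lemma integral_of_int [simp]: "integral (of_int a)"
  unfolding p_integral_iff[OF prime]
  by (rule exI[of _ a], rule exI[of _ 1]) (use prime in auto)

lemma integral_of_nat [simp]: "integral (of_nat a)"
  using integral_of_int[of "int a"] by simp

lemma integral_numeral [simp]: "integral (numeral a)" "integral 0" "integral 1" "integral (- 1)"
  using integral_of_int[of "numeral a"] integral_of_int[of 0] integral_of_int[of 1]
    integral_of_int[of "-1"] by simp_all

lemma integral_add [simp]:
  assumes "integral a" "integral b" shows "integral (a + b)"
proof -
  obtain x y z w where "\<not> int p dvd y" "a = of_int x / of_int y"
      "\<not> int p dvd w" "b = of_int z / of_int w"
    using assms unfolding p_integral_iff[OF prime] by blast
  moreover from this have "y \<noteq> 0" "w \<noteq> 0" by auto
  ultimately have "a + b = of_int (x * w + z * y) / of_int (y * w)" "\<not> int p dvd y * w"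
    using prime by (auto simp: field_simps prime_dvd_mult_iff)
  thus ?thesis unfolding p_integral_iff[OF prime] by blast
qed

lemma integral_mult [simp]:
  assumes "integral a" "integral b" shows "integral (a * b)"
proof -
  obtain x y z w where "\<not> int p dvd y" "a = of_int x / of_int y"
      "\<not> int p dvd w" "b = of_int z / of_int w"
    using assms unfolding p_integral_iff[OF prime] by blast
  hence "a * b = of_int (x * z) / of_int (y * w)" "\<not> int p dvd y * w"
    using prime by (auto simp: prime_dvd_mult_iff)
  thus ?thesis unfolding p_integral_iff[OF prime] by blast
qed

lemma integral_uminus [simp]: "integral a \<Longrightarrow> integral (- a)"
  using integral_mult[of "-1" a] by simp

lemma integral_diff [simp]: "integral a \<Longrightarrow> integral b \<Longrightarrow> integral (a - b)"
  using integral_add[of a "- b"] by simp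

lemma integral_power [simp]: "integral a \<Longrightarrow> integral (a ^ m)"
  by (induction m) simp_all

lemma integral_sum: "(\<And>x. x \<in> A \<Longrightarrow> integral (f x)) \<Longrightarrow> integral (sum f A)"
  by (induction A rule: infinite_finite_induct) simp_all

lemma integral_inverse_of_nat:
  assumes "\<not> p dvd a" shows "integral (1 / of_nat a)"
  unfolding p_integral_iff[OF prime]
  by (rule exI[of _ 1], rule exI[of _ "int a"]) (use assms in simp)

lemma integral_inverse_mult:
  "integral (1 / a) \<Longrightarrow> integral (1 / b) \<Longrightarrow> integral (1 / (a * b))"
  using integral_mult[of "1 / a" "1 / b"] by simp

lemma integral_inverse_power:
  "integral (1 / a) \<Longrightarrow> integral (1 / a ^ m)"
  using integral_power[of "1 / a" m] by (simp add: power_one_over)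

lemma integral_divide: "integral a \<Longrightarrow> integral (1 / b) \<Longrightarrow> integral (a / b)"
  using integral_mult[of a "1 / b"] by simp

lemma rat_congI:
  "integral b \<Longrightarrow> integral r \<Longrightarrow> a = b + of_nat p ^ m * r \<Longrightarrow> rat_cong p m a b"
  unfolding rat_cong_def by auto

lemma rat_congE:
  assumes "rat_cong p m a b"
  obtains r where "integral a" "integral b" "integral r" "a = b + of_nat p ^ m * r"
  using assms unfolding rat_cong_def by (metis add.commute diff_add_cancel)

lemma rat_cong_integral: "rat_cong p m a b \<Longrightarrow> integral a" "rat_cong p m a b \<Longrightarrow> integral b"
  by (simp_all add: rat_cong_def)

lemma rat_cong_refl: "integral a \<Longrightarrow> rat_cong p m a a"
  by (rule rat_congI[of _ 0]) simp_all

lemma rat_cong_sym: "rat_cong p m a b \<Longrightarrow> rat_cong p m b a"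
  by (erule rat_congE, rule rat_congI[of _ "- r" for r]) auto

lemma rat_cong_trans [trans]:
  assumes "rat_cong p m a b" "rat_cong p m b c" shows "rat_cong p m a c"
proof -
  obtain r s where "integral r" "a = b + of_nat p ^ m * r" "integral s" "b = c + of_nat p ^ m * s"
    using assms by (metis rat_congE)
  thus ?thesis using rat_cong_integral[OF assms(2)]
    by (intro rat_congI[of _ "r + s"]) (simp_all add: algebra_simps)
qed

lemma rat_cong_add:
  assumes "rat_cong p m a b" "rat_cong p m c d" shows "rat_cong p m (a + c) (b + d)"
proof -
  obtain r s where "integral r" "a = b + of_nat p ^ m * r" "integral s" "c = d + of_nat p ^ m * s"
    using assms by (metis rat_congE)
  thus ?thesis using assms[THEN rat_cong_integral(2)]
    by (intro rat_congI[of _ "r + s"]) (simp_all add: algebra_simps)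
qed

lemma rat_cong_mult:
  assumes "rat_cong p m a b" "rat_cong p m c d" shows "rat_cong p m (a * c) (b * d)"
proof -
  obtain r s where "integral r" "a = b + of_nat p ^ m * r" "integral s" "c = d + of_nat p ^ m * s"
    using assms by (metis rat_congE)
  thus ?thesis using assms[THEN rat_cong_integral(2)] 
    by (intro rat_congI[of _ "r * d + s * b + of_nat p ^ m * r * s"])
      (simp_all add: algebra_simps)
qed

lemma rat_cong_mult_left:
  "integral c \<Longrightarrow> rat_cong p m a b \<Longrightarrow> rat_cong p m (c * a) (c * b)"
  by (intro rat_cong_mult rat_cong_refl)

lemma rat_cong_mult_right:
  "integral c \<Longrightarrow> rat_cong p m a b \<Longrightarrow> rat_cong p m (a * c) (b * c)"
  by (intro rat_cong_mult rat_cong_refl)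

lemma rat_cong_diff:
  assumes "rat_cong p m a b" "rat_cong p m c d" shows "rat_cong p m (a - c) (b - d)"
  using rat_cong_add[OF assms(1) rat_cong_mult_left[OF _ assms(2), of "-1"]] by simp

lemma rat_cong_power: "rat_cong p m a b \<Longrightarrow> rat_cong p m (a ^ k) (b ^ k)"
  by (induction k) (simp_all add: rat_cong_mult rat_cong_refl)

lemma rat_cong_sum:
  "(\<And>x. x \<in> A \<Longrightarrow> rat_cong p m (f x) (g x)) \<Longrightarrow> rat_cong p m (sum f A) (sum g A)"
  by (induction A rule: infinite_finite_induct) (simp_all add: rat_cong_add rat_cong_refl)

text \<open>Cross-multiplication: \<open>a * d\<close> is congruent to \<open>b * c\<close>, and
  both are multiplied by the integral number \<open>1 / c * (1 / d)\<close>. Since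
  \<open>1 / 0 = 0\<close> is integral, nonzero denominators are a separate assumption.\<close>

lemma rat_cong_divide:
  assumes "rat_cong p m a b" "rat_cong p m c d" "integral (1 / c)" "integral (1 / d)"
    "c \<noteq> 0" "d \<noteq> 0"
  shows "rat_cong p m (a / c) (b / d)"
proof -
  have "rat_cong p m (a * d * (1 / c * (1 / d))) (b * c * (1 / c * (1 / d)))"
    by (intro rat_cong_mult_right integral_mult rat_cong_mult rat_cong_sym[of _ c d] assms)
  thus ?thesis using assms(5,6) by simp
qed

lemma rat_cong_mono: 
  assumes "rat_cong p m a b" "k \<le> m" shows "rat_cong p k a b"
proof -
  obtain r where r: "integral b" "integral r" "a = b + of_nat p ^ m * r"
    using assms(1) by (metis rat_congE)
  have "(of_nat p :: rat) ^ m = of_nat p ^ k * of_nat p ^ (m - k)"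
    using assms(2) by (simp flip: power_add)
  thus ?thesis using r by (intro rat_congI[of _ "of_nat p ^ (m - k) * r"]) simp_all
qed

lemma rat_cong_of_int:
  assumes "[a = b] (mod int p)" shows "of_int a \<approx> of_int b"
proof -
  obtain c where "a = b + int p * c"
    using assms by (metis cong_iff_lin cong_sym)
  thus ?thesis by (intro rat_congI[of _ "of_int c"]) simp_all
qed

text \<open>This lifts congruences from modulus \<open>p\<close> to modulus \<open>p ^ 2\<close>:
  the terms with \<open>k > n\<close> all carry a factor \<open>p\<close>, so only their cofactors
  modulo \<open>p\<close> matter.\<close>

lemma rat_cong_p_mult:
  assumes "rat_cong p m a b" shows "rat_cong p (Suc m) (of_nat p * a) (of_nat p * b)"
proof -
  obtain r where "integral b" "integral r" "a = b + of_nat p ^ m * r"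
    using assms by (metis rat_congE)
  thus ?thesis by (intro rat_congI[of _ r]) (simp_all add: algebra_simps)
qed

section \<open>Fermat's theorem and power sums over all residues\<close>

lemma fermat_rat:
  assumes "\<not> p dvd a" shows "of_nat a ^ (p - 1) \<approx> 1"
proof -
  have "[a ^ (p - 1) = 1] (mod p)" using prime assms by (rule fermat_theorem)
  hence "[int (a ^ (p - 1)) = int 1] (mod int p)" by (simp only: cong_int_iff)
  from rat_cong_of_int[OF this] show ?thesis by simp
qed

text \<open>Summing \<open>(i + 1) ^ (m + 1) - i ^ (m + 1)\<close> over \<open>i < p\<close>
  telescopes to \<open>p ^ (m + 1)\<close>. The binomial expansion expresses \<open>m + 1\<close>
  times the wanted sum by this and by lower power sums, and \<open>m + 1 < p\<close> can be
  cancelled modulo \<open>p\<close>.\<close>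

lemma power_sum_cong_0:
  assumes "m < p - 1" shows "int p dvd (\<Sum>i<p. int i ^ m)"
  using assms
proof (induction m rule: less_induct)
  case (less m)
  have "(\<Sum>i<N. int (Suc i) ^ Suc m - int i ^ Suc m) = int N ^ Suc m" for N
    by (subst sum_lessThan_telescope) simp
  moreover have "int (Suc i) ^ Suc m - int i ^ Suc m = (\<Sum>j\<le>m. int (Suc m choose j) * int i ^ j)"
    for i
    using binomial_ring[of "int i" 1 "Suc m"] by (simp add: add.commute)
  ultimately have "int p ^ Suc m = (\<Sum>i<p. \<Sum>j\<le>m. int (Suc m choose j) * int i ^ j)"
    by (simp only:)
  also have "\<dots> = (\<Sum>j\<le>m. int (Suc m choose j) * (\<Sum>i<p. int i ^ j))"
    by (subst sum.swap) (simp add: sum_distrib_left)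
  also have "\<dots> = (\<Sum>j<m. int (Suc m choose j) * (\<Sum>i<p. int i ^ j))
      + int (Suc m) * (\<Sum>i<p. int i ^ m)"
    by (simp add: lessThan_Suc_atMost[symmetric])
  finally have "int (Suc m) * (\<Sum>i<p. int i ^ m)
      = int p ^ Suc m - (\<Sum>j<m. int (Suc m choose j) * (\<Sum>i<p. int i ^ j))" by simp
  moreover have "int p dvd (\<Sum>j<m. int (Suc m choose j) * (\<Sum>i<p. int i ^ j))"
    using less by (intro dvd_sum[of "{..<m}"] dvd_mult) simp_all
  ultimately have "int p dvd int (Suc m) * (\<Sum>i<p. int i ^ m)"
    by (simp add: dvd_diff)
  moreover have "\<not> p dvd Suc m" using less.prems by (auto dest: dvd_imp_le)
  ultimately show ?case using prime
    by (metis of_nat_dvd_iff prime_dvd_mult_iff prime_nat_int_transfer)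
qed

lemma poly_sum_cong_0:
  assumes "Polynomial.degree f < p - 1" shows "int p dvd (\<Sum>i<p. poly f (int i))"
proof -
  have "(\<Sum>i<p. poly f (int i)) = (\<Sum>j\<le>Polynomial.degree f. Polynomial.coeff f j * (\<Sum>i<p. int i ^ j))"
    by (simp add: poly_altdef sum_distrib_left, rule sum.swap)
  thus ?thesis using assms by (auto intro!: dvd_sum dvd_mult power_sum_cong_0)
qed

end

section \<open>Euler numbers and alternating power sums\<close>

text \<open>For odd \<open>n\<close> the recurrence involves only the indices \<open>n - k\<close>
  with even \<open>k \<ge> 2\<close>, which are smaller and again odd.\<close>

lemma euler_number_odd: "odd n \<Longrightarrow> euler_number n = 0"
proof (induction n rule: less_induct)
  case (less n)
  have "(\<Sum>k\<in>{k\<in>{1..n}. even k}. int (n choose k) * euler_number (n - k)) = 0"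
    using less by (intro sum.neutral) auto
  thus ?case using less.prems by (subst euler_number.simps) (auto elim: oddE)
qed

text \<open>In terms of the classical Euler polynomials this is \<open>2 ^ m * E_m ((x + 1) / 2)\<close>.\<close>

definition euler_poly :: "nat \<Rightarrow> int \<Rightarrow> int" where
  "euler_poly m x = (\<Sum>k\<le>m. int (m choose k) * euler_number k * x ^ (m - k))"

lemma power_plus_1_add_power_minus_1:
  "((x::int) + 1) ^ m + (x - 1) ^ m = 2 * (\<Sum>j\<in>{j\<in>{0..m}. even j}. int (m choose j) * x ^ (m - j))"
proof -
  have "(x + 1) ^ m = (\<Sum>j\<le>m. int (m choose j) * x ^ (m - j))"
    using binomial_ring[of 1 x m] by (simp add: add.commute)
  moreover have "(x - 1) ^ m = (\<Sum>j\<le>m. int (m choose j) * (- 1) ^ j * x ^ (m - j))"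
    using binomial_ring[of "-1" x m] by (simp add: add.commute)
  ultimately have "(x + 1) ^ m + (x - 1) ^ m
     = (\<Sum>j\<le>m. if even j then 2 * (int (m choose j) * x ^ (m - j)) else 0)"
    by (auto simp flip: sum.distrib intro!: sum.cong)
  also have "\<dots> = (\<Sum>j\<in>{j\<in>{..m}. even j}. 2 * (int (m choose j) * x ^ (m - j)))"
    by (subst sum.inter_filter) auto
  finally show ?thesis by (simp add: sum_distrib_left atLeast0AtMost)
qed

text \<open>Expand both polynomials, keep the even \<open>j\<close> in
  \<open>(x + 1) ^ (m - k) + (x - 1) ^ (m - k)\<close>, and collect by \<open>s = k + j\<close>. The
  coefficient of \<open>x ^ (m - s)\<close> contains the defining recurrence at \<open>s\<close>, so
  only \<open>s = 0\<close> survives.\<close>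

lemma euler_poly_add:
  "euler_poly m (x + 1) + euler_poly m (x - 1) = 2 * x ^ m"
proof -
  let ?E = euler_number
  have "euler_poly m (x + 1) + euler_poly m (x - 1)
     = (\<Sum>k\<le>m. int (m choose k) * ?E k * ((x + 1) ^ (m - k) + (x - 1) ^ (m - k)))"
    by (simp add: euler_poly_def algebra_simps sum.distrib)
  also have "\<dots> = (\<Sum>k\<le>m. \<Sum>j\<in>{j\<in>{0..m-k}. even j}.
      2 * int (m choose k) * ?E k * int (m - k choose j) * x ^ (m - k - j))"
    by (simp add: power_plus_1_add_power_minus_1 sum_distrib_left
        mult.assoc mult.left_commute)
  also have "\<dots> = (\<Sum>(k,j)\<in>(SIGMA k:{..m}. {j\<in>{0..m-k}. even j}).
      2 * int (m choose k) * ?E k * int (m - k choose j) * x ^ (m - k - j))"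
    by (subst sum.Sigma) auto
  also have "\<dots> = (\<Sum>(s,j)\<in>(SIGMA s:{..m}. {j\<in>{0..s}. even j}).
      2 * x ^ (m - s) * int (m choose s) * (int (s choose j) * ?E (s - j)))"
  proof (rule sum.reindex_bij_witness[where i = "\<lambda>(s,j). (s - j, j)" and j = "\<lambda>(k,j). (k + j, j)"],
      goal_cases)
    \<comment> \<open>Goal 5 is the equality of corresponding terms. It rests on \<open>(m choose k)
      * (m - k choose j) = (m choose s) * (s choose j)\<close> with
      \<open>s = k + j\<close>.\<close>
    case (5 a)
    obtain k j where a: "a = (k, j)" by fastforce
    with 5 have "k + j \<le> m" by auto
    hence "(m choose k) * (m - k choose j) = (m choose (k + j)) * (k + j choose j)"
      using choose_mult[of k "k + j" m] binomial_symmetric[of k "k + j"] by simp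
    hence "int (m choose k) * int (m - k choose j) = int (m choose (k + j)) * int (k + j choose j)"
      by (metis of_nat_mult)
    thus ?case unfolding a by (simp add: algebra_simps diff_diff_left)
  qed auto
  also have "\<dots> = (\<Sum>s\<le>m. 2 * x ^ (m - s) * int (m choose s) *
       (\<Sum>j\<in>{j\<in>{0..s}. even j}. int (s choose j) * ?E (s - j)))"
    by (subst sum.Sigma[symmetric]) (auto simp: sum_distrib_left)
  also have "\<dots> = (\<Sum>s\<le>m. if s = 0 then 2 * x ^ m else 0)"
  proof (intro sum.cong refl)
    fix s
    have "{j\<in>{0..0}. even j} = {0::nat}" by auto
    thus "2 * x ^ (m - s) * int (m choose s) *
       (\<Sum>j\<in>{j\<in>{0..s}. even j}. int (s choose j) * ?E (s - j)) = (if s = 0 then 2 * x ^ m else 0)"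
      using euler_number_recurrence[of s] by (auto simp: euler_number_0)
  qed
  finally show ?thesis by simp
qed

text \<open>The values at \<open>1\<close> and \<open>- 1\<close> agree because odd Euler numbers
  vanish, and by the functional equation at \<open>x = 0\<close> they add up to
  \<open>0\<close>.\<close>

lemma euler_poly_1:
  assumes "even m" "m > 0" shows "euler_poly m 1 = 0"
proof -
  have "euler_poly m (- 1) = euler_poly m 1"
    unfolding euler_poly_def
  proof (intro sum.cong refl)
    fix k assume "k \<in> {..m}"
    thus "int (m choose k) * euler_number k * (- 1) ^ (m - k)
       = int (m choose k) * euler_number k * 1 ^ (m - k)"
      using assms by (cases "even k") (simp_all add: euler_number_odd)
  qed
  thus ?thesis using euler_poly_add[of m 0] assms by simp
qed

text \<open>The functional equation at \<open>x = 2 * i\<close> makes the alternating sum of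
  \<open>(2 * i) ^ m\<close> telescope; the boundary value at \<open>1\<close> vanishes.\<close>

lemma alternating_power_sum:
  assumes "even m" "m > 0"
  shows "2 * 2 ^ m * (\<Sum>i=1..n. (- 1) ^ i * int i ^ m) = (- 1) ^ n * euler_poly m (2 * int n + 1)"
proof (induction n)
  case 0
  thus ?case using euler_poly_1[OF assms] by simp
next
  case (Suc n)
  have "2 * 2 ^ m * (\<Sum>i=1..Suc n. (- 1) ^ i * int i ^ m)
      = (- 1) ^ n * (euler_poly m (2 * int n + 1) - 2 * (2 * int (Suc n)) ^ m)"
    using Suc by (simp only: power_mult_distrib) (simp add: algebra_simps)
  also have "\<dots> = (- 1) ^ n * - euler_poly m (2 * int (Suc n) + 1)"
  proof -
    have "euler_poly m (2 * int n + 1) - 2 * (2 * int (Suc n)) ^ m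
        = - euler_poly m (2 * int (Suc n) + 1)"
      using euler_poly_add[of m "2 * int (Suc n)"] by (simp add: add.commute)
    thus ?thesis by simp
  qed
  finally show ?case by simp
qed

lemma euler_poly_cong: "[euler_poly m x = euler_number m] (mod x)"
proof -
  have "euler_poly m x = (\<Sum>k<m. int (m choose k) * euler_number k * x ^ (m - k)) + euler_number m"
    by (simp add: euler_poly_def flip: lessThan_Suc_atMost)
  moreover have "x dvd (\<Sum>k<m. int (m choose k) * euler_number k * x ^ (m - k))"
    by (intro dvd_sum dvd_mult) simp
  ultimately show ?thesis by (simp add: cong_iff_dvd_diff)
qed

section \<open>Chebyshev-type polynomials with binomial coefficients\<close>

lemma of_nat_binomial_Suc:
  "of_nat (N choose Suc r) * (of_nat r + 1) = (of_nat N - of_nat r :: rat) * of_nat (N choose r)"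
proof -
  have "of_nat (Suc N * (N choose r)) = (of_nat ((Suc N choose Suc r) * Suc r) :: rat)"
    by (simp only: Suc_times_binomial_eq)
  thus ?thesis by (simp add: algebra_simps)
qed

text \<open>Absorption applied twice, with denominators cleared. For \<open>p = 2 * n + 1\<close>
  the factor \<open>(n + k + 1) * (n - k)\<close> is \<open>(p ^ 2 - (2 * k + 1) ^ 2) / 4\<close>,
  the source of the congruence modulo \<open>p ^ 2\<close>.\<close>

lemma binomial_add_double_Suc:
  "of_nat (Suc (n + k) choose (2 * k + 2)) * ((2 * of_nat k + 1) * (2 * of_nat k + 2))
     = (of_nat (n + k choose (2 * k)) * (of_nat n + of_nat k + 1) * (of_nat n - of_nat k) :: rat)"
proof -
  have "of_nat (Suc (n + k) * (n + k choose Suc (2 * k)))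
      = (of_nat ((Suc (n + k) choose Suc (Suc (2 * k))) * Suc (Suc (2 * k))) :: rat)"
    by (simp only: Suc_times_binomial_eq)
  hence 1: "of_nat (Suc (n + k) choose (2 * k + 2)) * (2 * of_nat k + 2)
      = (of_nat n + of_nat k + 1 :: rat) * of_nat (n + k choose Suc (2 * k))"
    by (simp only: of_nat_mult of_nat_Suc of_nat_add) (simp add: algebra_simps)
  have 2: "of_nat (n + k choose Suc (2 * k)) * (2 * of_nat k + 1)
      = (of_nat n - of_nat k) * (of_nat (n + k choose (2 * k)) :: rat)"
    using of_nat_binomial_Suc[of "n + k" "2 * k"] by simp
  have "of_nat (Suc (n + k) choose (2 * k + 2)) * ((2 * of_nat k + 1) * (2 * of_nat k + 2))
      = of_nat (Suc (n + k) choose (2 * k + 2)) * (2 * of_nat k + 2) * (2 * of_nat k + 1 :: rat)"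
    by (simp only: mult_ac)
  also have "\<dots> = (of_nat n + of_nat k + 1) * (of_nat (n + k choose Suc (2 * k)) * (2 * of_nat k + 1))"
    unfolding 1 by (simp only: mult_ac)
  finally show ?thesis unfolding 2 by (simp only: mult_ac)
qed

lemma central_binomial_Suc:
  "of_nat (2 * Suc k choose Suc k) * (of_nat k + 1)
     = (2 * (2 * of_nat k + 1) * of_nat (2 * k choose k) :: rat)"
proof -
  have "(2 * Suc k choose Suc k) = (Suc (2 * k) choose k) + (Suc (2 * k) choose Suc k)"
    by simp
  also have "(Suc (2 * k) choose k) = (Suc (2 * k) choose Suc k)"
    by (subst binomial_symmetric) simp_all
  finally have "(2 * Suc k choose Suc k) * Suc k = 2 * ((Suc (2 * k) choose Suc k) * Suc k)"
    by (simp only: algebra_simps)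
  also have "\<dots> = 2 * (Suc (2 * k) * (2 * k choose k))"
    by (simp only: Suc_times_binomial_eq)
  finally have "of_nat ((2 * Suc k choose Suc k) * Suc k)
      = (of_nat (2 * (Suc (2 * k) * (2 * k choose k))) :: rat)" by (simp only:)
  thus ?thesis
    by (simp only: of_nat_mult of_nat_Suc of_nat_numeral) (simp add: algebra_simps)
qed

text \<open>With \<open>y = 4 sin\<^sup>2 t\<close> this is \<open>sin (2 n t) / sin (2 t)\<close>.\<close>

definition cheb :: "int \<Rightarrow> nat \<Rightarrow> int" where
  "cheb y n = (\<Sum>k<n. int (n + k choose (2 * k + 1)) * (- y) ^ k)"

text \<open>The binomial coefficients vanish for \<open>k \<ge> n\<close>, so polynomials of
  different index can be compared over a common range.\<close>

lemma cheb_eq_sum: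
  "n \<le> N \<Longrightarrow> cheb y n = (\<Sum>k<N. int (n + k choose (2 * k + 1)) * (- y) ^ k)"
  unfolding cheb_def by (rule sum.mono_neutral_left) auto

lemma cheb_0: "cheb y 0 = 0"
  and cheb_1: "cheb y (Suc 0) = 1"
  by (simp_all add: cheb_def)

text \<open>By Pascal's rule, the second difference in \<open>n\<close> of the coefficient of
  \<open>(- y) ^ (j + 1)\<close> is the coefficient of \<open>(- y) ^ j\<close> at the middle
  index.\<close>

lemma cheb_Suc_Suc: "cheb y (Suc (Suc n)) = (2 - y) * cheb y (Suc n) - cheb y n"
proof -
  define b where "b m k = int (m + k choose (2 * k + 1))" for m k
  have c: "cheb y m = (\<Sum>k<N. b m k * (- y) ^ k)" if "m \<le> N" for m N
    using cheb_eq_sum[OF that] by (simp add: b_def)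
  have b0: "b (Suc (Suc n)) 0 = 2 * b (Suc n) 0 - b n 0" by (simp add: b_def)
  have bS: "b (Suc (Suc n)) (Suc j) = 2 * b (Suc n) (Suc j) - b n (Suc j) + b (Suc n) j" for j
    by (simp add: b_def)
  have "cheb y (Suc (Suc n)) = b (Suc (Suc n)) 0
      + (\<Sum>j<Suc n. b (Suc (Suc n)) (Suc j) * (- y) ^ Suc j)"
    by (subst c[OF order.refl], subst sum.lessThan_Suc_shift) simp
  also have "\<dots> = 2 * (b (Suc n) 0 + (\<Sum>j<Suc n. b (Suc n) (Suc j) * (- y) ^ Suc j))
       - (b n 0 + (\<Sum>j<Suc n. b n (Suc j) * (- y) ^ Suc j))
       + (\<Sum>j<Suc n. b (Suc n) j * (- y) ^ Suc j)"
    unfolding b0 bS by (simp add: ring_distribs sum.distrib sum_subtractf sum_distrib_left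
        mult.assoc sum_negf del: sum.lessThan_Suc)
  also have "b (Suc n) 0 + (\<Sum>j<Suc n. b (Suc n) (Suc j) * (- y) ^ Suc j) = cheb y (Suc n)"
    by (subst c[of _ "Suc (Suc n)"], simp, subst sum.lessThan_Suc_shift) simp
  also have "b n 0 + (\<Sum>j<Suc n. b n (Suc j) * (- y) ^ Suc j) = cheb y n"
    by (subst c[of _ "Suc (Suc n)"], simp, subst sum.lessThan_Suc_shift) simp
  also have "(\<Sum>j<Suc n. b (Suc n) j * (- y) ^ Suc j) = - y * cheb y (Suc n)"
    by (subst c[of _ "Suc n"], simp, simp only: sum_distrib_left) (simp add: mult_ac)
  finally show ?thesis by (simp add: algebra_simps)
qed

text \<open>At \<open>y = 4\<close> the recurrence has characteristic polynomial
  \<open>(t + 1) ^ 2\<close>, with the double root \<open>- 1\<close>.\<close>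

lemma cheb_4: "cheb 4 n = - ((- 1) ^ n * int n)"
  by (induction n rule: induct_nat_012) (simp_all add: cheb_0 cheb_1 cheb_Suc_Suc algebra_simps)

text \<open>At \<open>y = 1\<close> the characteristic polynomial is \<open>t ^ 2 - t + 1\<close>;
  its roots are primitive sixth roots of unity, with cube \<open>- 1\<close>.\<close>

lemma cheb_one_add_3: "cheb 1 (Suc (Suc (Suc n))) = - cheb 1 n"
  by (simp add: cheb_Suc_Suc)

lemma cheb_one:
  "cheb 1 n = (if n mod 3 = 0 then 0 else (-1) ^ (n div 3))"
proof (induction n rule: less_induct)
  case (less n)
  show ?case
  proof (cases "n < 3")
    case True
    hence "n = 0 \<or> n = 1 \<or> n = 2" by auto
    moreover have "cheb 1 2 = 1" by (simp only: numeral_2_eq_2 cheb_Suc_Suc cheb_0 cheb_1) simp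
    ultimately show ?thesis by (auto simp: cheb_0 cheb_1)
  next
    case False
    then obtain m where m: "n = Suc (Suc (Suc m))"
      by (metis One_nat_def Suc_lessI less_Suc_eq_0_disj not0_implies_Suc not_less_eq numeral_3_eq_3)
    have "n mod 3 = m mod 3" "n div 3 = Suc (m div 3)" using m by simp_all
    thus ?thesis using less[of m] m by (simp add: cheb_one_add_3)
  qed
qed

text \<open>This is the exact integration of \<open>cos ((2 n + 1) t) / cos t\<close> as a
  polynomial in \<open>sin t\<close>; with \<open>y = 4 sin\<^sup>2 t\<close> the sum of the two
  \<open>cheb\<close> values is \<open>sin ((2 n + 1) t) / sin t\<close>. The identity holds term by
  term.\<close>

lemma sum_binomial_div_odd:
  "(\<Sum>k\<le>n. of_nat (n + k choose (2 * k)) * (- of_int y) ^ k / (2 * of_nat k + 1))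
     = (of_int (cheb y (Suc n) + cheb y n) / (2 * of_nat n + 1) :: rat)"
proof -
  have "of_nat (n + k choose (2 * k)) / (2 * of_nat k + 1)
     = (of_nat ((Suc n + k choose (2 * k + 1)) + (n + k choose (2 * k + 1))) / (2 * of_nat n + 1) :: rat)"
    for k
  proof -
    have "of_nat (n + k choose (2 * k)) * (2 * of_nat n + 1)
      = (of_nat ((Suc n + k choose (2 * k + 1)) + (n + k choose (2 * k + 1))) * (2 * of_nat k + 1) :: rat)"
      using of_nat_binomial_Suc[of "n + k" "2 * k"] by (simp add: algebra_simps)
    moreover have "2 * of_nat k + 1 \<noteq> (0 :: rat)" "2 * of_nat n + 1 \<noteq> (0 :: rat)"
      by (metis of_nat_Suc of_nat_eq_0_iff of_nat_mult of_nat_numeral Suc_not_Zero add.commute)+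
    ultimately show ?thesis by (simp add: frac_eq_eq)
  qed
  hence "(\<Sum>k\<le>n. of_nat (n + k choose (2 * k)) * (- of_int y) ^ k / (2 * of_nat k + 1))
      = (\<Sum>k<Suc n. (of_nat ((Suc n + k choose (2 * k + 1)) + (n + k choose (2 * k + 1)))
            / (2 * of_nat n + 1)) * (- of_int y :: rat) ^ k)"
    unfolding lessThan_Suc_atMost by (intro sum.cong refl) (metis times_divide_eq_left)
  also have "\<dots> = of_int (cheb y (Suc n) + cheb y n) / (2 * of_nat n + 1)"
    unfolding cheb_eq_sum[OF order.refl, of y "Suc n"] cheb_eq_sum[OF le_SucI[OF order.refl], of y n]
    by (simp add: sum_distrib_left sum_divide_distrib field_simps sum.distrib[symmetric]
        del: sum.lessThan_Suc binomial_Suc_Suc)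
  finally show ?thesis .
qed

text \<open>The coefficients of \<open>u ^ i + u ^ (-i)\<close> as a polynomial in \<open>u + 1 / u - 2\<close>.\<close>

definition lucas_coeff :: "nat \<Rightarrow> nat \<Rightarrow> nat" where
  "lucas_coeff i k = (i + k choose (2 * k)) + (i + k - 1 choose (2 * k))"

text \<open>With \<open>y = 4 sin\<^sup>2 t\<close> the difference is \<open>2 cos (2 i t)\<close>,
  hence \<open>u ^ i + u ^ (-i)\<close> for \<open>y = 2 - u - 1 / u\<close>. The bound
  \<open>N\<close> is uniform so that sums over \<open>i\<close> and \<open>k\<close> can be
  interchanged.\<close>

lemma cheb_diff:
  assumes "1 \<le> i" "i \<le> N"
  shows "cheb y (i + 1) - cheb y (i - 1) = (\<Sum>k\<le>N. int (lucas_coeff i k) * (- y) ^ k)"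
proof -
  obtain m where m: "i = Suc m" using assms by (cases i) auto
  have "cheb y (i + 1) = (\<Sum>k<Suc N. int (i + 1 + k choose (2 * k + 1)) * (- y) ^ k)"
    "cheb y (i - 1) = (\<Sum>k<Suc N. int (i - 1 + k choose (2 * k + 1)) * (- y) ^ k)"
    using assms by (intro cheb_eq_sum; simp)+
  thus ?thesis
    by (simp only: lessThan_Suc_atMost lucas_coeff_def m sum_subtractf[symmetric])
      (simp add: algebra_simps)
qed

lemma lucas_coeff_0: "lucas_coeff i 0 = 2"
  by (simp add: lucas_coeff_def)

lemma lucas_coeff_mult:
  assumes "i \<ge> 1"
  shows "of_nat (lucas_coeff i k) * (of_nat i + of_nat k)
     = (2 * of_nat i * of_nat (i + k choose (2 * k)) :: rat)"
proof -
  obtain m where m: "i = Suc m" using assms by (cases i) auto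
  show ?thesis
  proof (cases k)
    case (Suc j)
    show ?thesis
      using of_nat_binomial_Suc[of "m + k" "2 * j + 1"]
      by (simp add: lucas_coeff_def m Suc algebra_simps)
  qed (simp add: lucas_coeff_def)
qed

text \<open>For \<open>k > 0\<close> the coefficient is \<open>i ^ 2\<close> times an even
  polynomial in \<open>i\<close>, so division by \<open>i ^ 2\<close> leaves a polynomial.
  Consecutive coefficients have ratio \<open>(i ^ 2 - k ^ 2) / ((2 k + 1) (2 k + 2))\<close>; the
  factor \<open>j = i\<close> accounts for the vanishing ones.\<close>

lemma lucas_coeff_eq_prod:
  assumes "i \<ge> 1"
  shows "of_nat (lucas_coeff i (Suc k)) * fact (2 * Suc k)
     = (2 * of_nat i ^ 2 * of_int (\<Prod>j=1..k. int i ^ 2 - int j ^ 2) :: rat)"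
proof (induction k)
  case 0
  have "of_nat (lucas_coeff i 1) * (of_nat i + 1)
     = (2 * of_nat i * of_nat (i + 1 choose 2) :: rat)"
    using lucas_coeff_mult[OF assms, of 1] by simp
  also have "of_nat (i + 1 choose 2) * 2 = (of_nat i * (of_nat i + 1) :: rat)"
    using binomial_add_double_Suc[of i 0] by (simp add: algebra_simps numeral_2_eq_2)
  hence "(2 * of_nat i * of_nat (i + 1 choose 2) :: rat) = of_nat i ^ 2 * (of_nat i + 1)"
    by (simp add: power2_eq_square algebra_simps)
  finally have "of_nat (lucas_coeff i 1) = (of_nat i ^ 2 :: rat)"
    by (simp add: add_eq_0_iff_both_eq_0)
  thus ?case by simp
next
  case (Suc k)
  let ?k = "of_nat (Suc k) :: rat" and ?i = "of_nat i :: rat"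
  have "of_nat (lucas_coeff i (Suc (Suc k))) * (?i + ?k + 1) * (2 * ?k + 1) * (2 * ?k + 2)
      = 2 * ?i * (of_nat (Suc (i + Suc k) choose (2 * Suc k + 2)) * ((2 * ?k + 1) * (2 * ?k + 2)))"
    using lucas_coeff_mult[OF assms, of "Suc (Suc k)"] by (simp add: algebra_simps)
  also have "\<dots> = 2 * ?i * (of_nat (i + Suc k choose (2 * Suc k)) * (?i + ?k + 1) * (?i - ?k))"
    by (subst binomial_add_double_Suc) (rule refl)
  also have "\<dots> = of_nat (lucas_coeff i (Suc k)) * (?i + ?k) * (?i + ?k + 1) * (?i - ?k)"
    using lucas_coeff_mult[OF assms, of "Suc k"] by (simp only: mult_ac)
  finally have *: "(?i + ?k + 1) * (of_nat (lucas_coeff i (Suc (Suc k))) * ((2 * ?k + 1) * (2 * ?k + 2)))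
     = (?i + ?k + 1) * (of_nat (lucas_coeff i (Suc k)) * (?i ^ 2 - ?k ^ 2))"
    by (simp only: power2_eq_square algebra_simps)
  have "?i + ?k + 1 = of_nat (Suc (i + Suc k))" by simp
  hence "?i + ?k + 1 \<noteq> 0" by (metis of_nat_eq_0_iff Suc_not_Zero)
  with * have step: "of_nat (lucas_coeff i (Suc (Suc k))) * ((2 * ?k + 1) * (2 * ?k + 2))
     = of_nat (lucas_coeff i (Suc k)) * (?i ^ 2 - ?k ^ 2)"
    by (simp only: mult_cancel_left) simp
  have fact: "fact (2 * Suc (Suc k)) = (fact (2 * Suc k) * ((2 * ?k + 1) * (2 * ?k + 2)) :: rat)"
    by (simp add: algebra_simps)
  have "of_nat (lucas_coeff i (Suc (Suc k))) * fact (2 * Suc (Suc k))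
     = fact (2 * Suc k) * (of_nat (lucas_coeff i (Suc (Suc k))) * ((2 * ?k + 1) * (2 * ?k + 2)))"
    by (subst fact) (simp only: mult_ac)
  also have "\<dots> = of_nat (lucas_coeff i (Suc k)) * fact (2 * Suc k) * (?i ^ 2 - ?k ^ 2)"
    unfolding step by (simp only: mult_ac)
  also have "\<dots> = 2 * ?i ^ 2 * of_int (\<Prod>j=1..Suc k. int i ^ 2 - int j ^ 2)"
    unfolding Suc.IH by (simp add: mult.assoc)
  finally show ?case .
qed

lemma cong_poly:
  fixes f :: "int poly"
  shows "[x = y] (mod m) \<Longrightarrow> [poly f x = poly f y] (mod m)"
  unfolding poly_altdef by (intro cong_sum cong_scalar_left cong_pow)

lemma prod_neg_squares: "(\<Prod>j=1..k. - (int j ^ 2)) = (- 1) ^ k * fact k ^ 2"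
  by (induction k) (simp_all add: power2_eq_square algebra_simps)

section \<open>The sums modulo an odd prime\<close>

locale rat_cong_odd_prime = rat_cong_prime +
  fixes n :: nat
  assumes p_eq: "p = 2 * n + 1"
begin

lemma n_pos: "n > 0"
  using p_eq prime by (cases n) auto

lemma of_nat_p: "(of_nat p :: rat) = 2 * of_nat n + 1"
  by (simp add: p_eq)

lemma not_dvd_between: "0 < k \<Longrightarrow> k < p \<Longrightarrow> \<not> p dvd k"
  by (auto dest: dvd_imp_le)

lemma integral_inverse_less: "0 < k \<Longrightarrow> k < p \<Longrightarrow> integral (1 / of_nat k)"
  by (intro integral_inverse_of_nat not_dvd_between)

lemma integral_inverse_2: "integral (1 / 2)"
  using integral_inverse_less[of 2] p_eq n_pos by simp

lemma integral_inverse_power_2: "integral (1 / 4 ^ k)" "integral (1 / 16 ^ k)"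
proof -
  have "integral (1 / (2 ^ 2) ^ k)" "integral (1 / (2 ^ 4) ^ k)"
    by (intro integral_inverse_power integral_inverse_2)+
  thus "integral (1 / 4 ^ k)" "integral (1 / 16 ^ k)" by simp_all
qed

lemma integral_inverse_odd: "2 * k + 1 < p \<Longrightarrow> integral (1 / (2 * of_nat k + 1))"
  using integral_inverse_less[of "2 * k + 1"] by (simp add: add.commute)

lemma four_power_n: "4 ^ n \<approx> 1"
proof -
  have "\<not> p dvd 2" using p_eq n_pos by (intro not_dvd_between) auto
  from fermat_rat[OF this] show ?thesis by (simp add: p_eq power_mult)
qed

lemma sixteen_power_n: "16 ^ n \<approx> 1"
  using rat_cong_power[OF four_power_n, of 2] by (simp flip: power_mult_distrib add: power2_eq_square)

section \<open>Central binomial coefficients and the sums over \<open>k < n\<close>\<close>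

lemma not_dvd_central_binomial:
  assumes "k \<le> n" shows "\<not> p dvd (2 * k choose k)"
proof
  assume "p dvd (2 * k choose k)"
  hence "p dvd fact k * fact (2 * k - k) * (2 * k choose k)" by simp
  also have "fact k * fact (2 * k - k) * (2 * k choose k) = (fact (2 * k) :: nat)"
    by (rule binomial_fact_lemma) simp
  finally show False using prime assms p_eq by (simp add: prime_dvd_fact_iff)
qed

lemma integral_inverse_central_binomial:
  "k \<le> n \<Longrightarrow> integral (1 / of_nat (2 * k choose k))"
  by (intro integral_inverse_of_nat not_dvd_central_binomial)

text \<open>Induction on \<open>k\<close>, comparing ratios of consecutive terms: they differ only
  by \<open>(n + k + 1) * (n - k)\<close> against \<open>- (2 k + 1) ^ 2 / 4\<close>, and the
  difference \<open>p ^ 2 / 4\<close> has no part linear in \<open>p\<close>.\<close>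

lemma binomial_add_double_cong:
  assumes "k \<le> n"
  shows "rat_cong p 2 (of_nat (n + k choose (2 * k))) ((- 1) ^ k * of_nat (2 * k choose k) / 16 ^ k)"
  using assms
proof (induction k)
  case 0
  show ?case by (simp add: rat_cong_refl)
next
  case (Suc k)
  let ?k = "of_nat k :: rat" and ?C = "of_nat (2 * k choose k) :: rat"
  define u where "u = 1 / ((2 * ?k + 1) * (2 * ?k + 2))"
  have ne: "2 * ?k + 1 \<noteq> 0" "2 * ?k + 2 \<noteq> 0" "?k + 1 \<noteq> 0"
    using of_nat_neq_0[of "2 * k", where ?'a = rat] of_nat_neq_0[of "2 * k + 1", where ?'a = rat]
      of_nat_neq_0[of k, where ?'a = rat]
    by (simp_all add: algebra_simps)
  have "integral (1 / (2 * ?k + 1))" "integral (1 / (2 * ?k + 2))"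
    using integral_inverse_less[of "2 * k + 1"] integral_inverse_less[of "2 * k + 2"] Suc.prems p_eq
    by (simp_all add: algebra_simps)
  hence u: "integral u" unfolding u_def by (rule integral_inverse_mult)
  have four: "integral (1 / 4)" using integral_inverse_power_2(1)[of 1] by simp
  have eq1: "of_nat (n + Suc k choose (2 * Suc k))
     = of_nat (n + k choose (2 * k)) * ((of_nat n + ?k + 1) * (of_nat n - ?k) * u)"
  proof -
    have "of_nat (Suc (n + k) choose (2 * k + 2))
       = of_nat (n + k choose (2 * k)) * ((of_nat n + ?k + 1) * (of_nat n - ?k) * u)"
      using binomial_add_double_Suc[of n k] ne unfolding u_def
      by (simp add: eq_divide_eq mult.assoc del: binomial_Suc_Suc)
    moreover have "n + Suc k = Suc (n + k)" "2 * Suc k = 2 * k + 2" by simp_all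
    ultimately show ?thesis by (simp only:)
  qed
  have eq2: "(- 1) ^ Suc k * of_nat (2 * Suc k choose Suc k) / 16 ^ Suc k
     = ((- 1) ^ k * ?C / 16 ^ k) * (- ((2 * ?k + 1) ^ 2) * (1 / 4) * u)"
  proof -
    have "2 * (2 * x + 1) * c / (x + 1) = 4 * (2 * x + 1) ^ 2 * c * (1 / ((2 * x + 1) * (2 * x + 2)))"
      if "2 * x + 1 \<noteq> 0" "x + 1 \<noteq> 0" for x c :: rat
    proof -
      have "2 * x + 2 = 2 * (x + 1)" by simp
      thus ?thesis using that by (simp add: power2_eq_square del: distrib_left_numeral)
    qed
    from this[OF ne(1,3), of ?C]
    have "of_nat (2 * Suc k choose Suc k) = 4 * (2 * ?k + 1) ^ 2 * ?C * u"
      using central_binomial_Suc[of k] ne(3) unfolding u_def by (metis nonzero_eq_divide_eq)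
    thus ?thesis by (simp only: power_Suc) (simp add: mult_ac)
  qed
  have "(of_nat n + ?k + 1) * (of_nat n - ?k)
     = - ((2 * ?k + 1) ^ 2) * (1 / 4) + of_nat p ^ 2 * (1 / 4)"
    by (simp add: of_nat_p power2_eq_square field_simps)
  moreover have "integral (- ((2 * ?k + 1) ^ 2) * (1 / 4))"
    by (intro integral_mult integral_uminus integral_power integral_add four) simp_all
  ultimately have "rat_cong p 2 ((of_nat n + ?k + 1) * (of_nat n - ?k)) (- ((2 * ?k + 1) ^ 2) * (1 / 4))"
    using four by (intro rat_congI[of _ "1/4"])
  thus ?case unfolding eq1 eq2
    using Suc u by (intro rat_cong_mult[OF _ rat_cong_mult_right]) simp_all
qed

text \<open>The case \<open>k = n\<close> of the preceding congruence, where the left binomial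
  coefficient is \<open>1\<close>, combined with \<open>16 ^ n \<equiv> 1\<close>.\<close>

lemma central_binomial_n: "of_nat (2 * n choose n) \<approx> (- 1) ^ n"
proof -
  have "1 \<approx> (- 1) ^ n * of_nat (2 * n choose n) / 16 ^ n"
    using rat_cong_mono[OF binomial_add_double_cong[of n], of "Suc 0"] by (simp add: mult_2)
  from rat_cong_mult_right[OF _ this, of "16 ^ n"]
  have "16 ^ n \<approx> (- 1) ^ n * of_nat (2 * n choose n)" by simp
  from rat_cong_trans[OF rat_cong_sym[OF this] sixteen_power_n]
  have "(- 1) ^ n * of_nat (2 * n choose n) \<approx> 1" .
  from rat_cong_mult_left[OF _ this, of "(- 1) ^ n"]
  show ?thesis by (simp flip: mult.assoc power_add mult_2)
qed

text \<open>Each term is replaced by the one with \<open>n + k choose 2 k\<close>, whose sum up to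
  \<open>k = n\<close> is known exactly. The replacement stops at \<open>k < n\<close>, where
  \<open>2 k + 1\<close> is still prime to \<open>p\<close>.\<close>

lemma lower_sum_cong:
  "rat_cong p 2 (\<Sum>k<n. of_nat (2 * k choose k) * (of_int y / 16) ^ k / (2 * of_nat k + 1))
     ((of_int (cheb y (Suc n) + cheb y n) - (- of_int y) ^ n) / of_nat p)"
proof -
  have "rat_cong p 2 (\<Sum>k<n. of_nat (2 * k choose k) * (of_int y / 16) ^ k / (2 * of_nat k + 1))
     (\<Sum>k<n. of_nat (n + k choose (2 * k)) * (- of_int y) ^ k / (2 * of_nat k + 1))"
  proof (rule rat_cong_sum, rule rat_cong_sym)
    fix k assume k: "k \<in> {..<n}"
    have "of_nat (2 * k choose k) * (of_int y / 16) ^ k / (2 * of_nat k + 1)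
        = (- 1) ^ k * of_nat (2 * k choose k) / 16 ^ k * ((- of_int y) ^ k * (1 / (2 * of_nat k + 1)) :: rat)"
    proof -
      have "(- 1) ^ k * (- of_int y) ^ k = (of_int y ^ k :: rat)"
        by (simp flip: power_mult_distrib)
      thus ?thesis by (simp add: power_divide)
    qed
    moreover have "integral ((- of_int y) ^ k * (1 / (2 * of_nat k + 1)))"
      using k p_eq by (intro integral_mult integral_power integral_uminus integral_of_int
          integral_inverse_odd) auto
    ultimately show "rat_cong p 2
        (of_nat (n + k choose (2 * k)) * (- of_int y) ^ k / (2 * of_nat k + 1))
        (of_nat (2 * k choose k) * (of_int y / 16) ^ k / (2 * of_nat k + 1))"
      using rat_cong_mult_right[OF _ binomial_add_double_cong[of k],
          of "(- of_int y) ^ k * (1 / (2 * of_nat k + 1))"] k by simp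
  qed
  also have "(\<Sum>k<n. of_nat (n + k choose (2 * k)) * (- of_int y) ^ k / (2 * of_nat k + 1))
     = ((of_int (cheb y (Suc n) + cheb y n) - (- of_int y) ^ n) / of_nat p :: rat)"
  proof -
    define f where "f k = of_nat (n + k choose (2 * k)) * (- of_int y) ^ k / (2 * of_nat k + 1 :: rat)" for k
    have "(\<Sum>k\<le>n. f k) = of_int (cheb y (Suc n) + cheb y n) / of_nat p"
      unfolding f_def of_nat_p by (rule sum_binomial_div_odd)
    moreover have "(\<Sum>k\<le>n. f k) = (\<Sum>k<n. f k) + f n"
      by (simp flip: lessThan_Suc_atMost)
    \<comment> \<open>At \<open>k = n\<close> the binomial coefficient is \<open>1\<close> and the
      denominator is \<open>p\<close> itself; this term is split off from the closed form.\<close>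
    moreover have "f n = (- of_int y) ^ n / of_nat p"
      unfolding f_def of_nat_p by (simp flip: mult_2)
    ultimately show ?thesis unfolding f_def[symmetric] by (simp add: diff_divide_distrib)
  qed
  finally show ?thesis .
qed

section \<open>Even polynomials and inverse squares over half of the residues\<close>

lemma half_sum_poly_cong:
  assumes "Polynomial.degree f < p - 1" "\<And>x. poly f (- x) = poly f x"
  shows "[2 * (\<Sum>i=1..n. poly f (int i)) = - poly f 0] (mod int p)"
proof -
  have "(\<Sum>i<p. poly f (int i)) = (\<Sum>i\<in>insert 0 ({1..n} \<union> {n+1..2*n}). poly f (int i))"
    by (rule sum.cong) (auto simp: p_eq)
  also have "\<dots> = poly f 0 + ((\<Sum>i=1..n. poly f (int i)) + (\<Sum>i=n+1..2*n. poly f (int i)))"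
    by (subst sum.insert, simp, simp, subst sum.union_disjoint) auto
  \<comment> \<open>The upper residues are the negatives of the lower ones, so an even polynomial
    has the same sum over both halves; the residue \<open>0\<close> contributes
    \<open>poly f 0\<close>.\<close>
  also have "(\<Sum>i=n+1..2*n. poly f (int i)) = (\<Sum>i=1..n. poly f (int (p - i)))"
    by (rule sum.reindex_bij_witness[where i = "\<lambda>i. p - i" and j = "\<lambda>i. p - i"])
      (auto simp: p_eq)
  finally have "[poly f 0 + ((\<Sum>i=1..n. poly f (int i)) + (\<Sum>i=1..n. poly f (int (p - i)))) = 0] (mod int p)"
    using poly_sum_cong_0[OF assms(1)] by (simp add: cong_0_iff)
  moreover have "[(\<Sum>i=1..n. poly f (int (p - i))) = (\<Sum>i=1..n. poly f (int i))] (mod int p)"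
  proof (intro cong_sum)
    fix i assume "i \<in> {1..n}"
    hence "[int (p - i) = - int i] (mod int p)"
      by (simp add: cong_iff_dvd_diff p_eq of_nat_diff)
    from cong_poly[OF this, of f] show "[poly f (int (p - i)) = poly f (int i)] (mod int p)"
      by (simp add: assms(2))
  qed
  ultimately have "[poly f 0 + ((\<Sum>i=1..n. poly f (int i)) + (\<Sum>i=1..n. poly f (int i))) = 0] (mod int p)"
    by (meson cong_add_lcancel cong_sym cong_trans)
  thus ?thesis by (simp add: cong_iff_dvd_diff algebra_simps)
qed

lemma inverse_square_cong:
  assumes "p > 3" "0 < i" "i < p"
  shows "of_nat i ^ (p - 3) \<approx> 1 / of_nat i ^ 2"
proof -
  have "of_nat i ^ (p - 1) * (1 / of_nat i ^ 2) \<approx> 1 * (1 / of_nat i ^ 2)"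
    using assms by (intro rat_cong_mult_right fermat_rat integral_inverse_power
        integral_inverse_less not_dvd_between) auto
  moreover have "p - 1 = (p - 3) + 2" using assms by simp
  hence "(of_nat i :: rat) ^ (p - 1) = of_nat i ^ (p - 3) * of_nat i ^ 2"
    by (simp only: power_add)
  ultimately show ?thesis using assms by simp
qed

text \<open>Modulo \<open>p\<close> the terms are \<open>i ^ (p - 3)\<close>, an even monomial of
  degree below \<open>p - 1\<close> that vanishes at \<open>0\<close> because
  \<open>p > 3\<close>.\<close>

lemma half_harmonic_squares_cong:
  assumes "p > 3"
  shows "(\<Sum>i=1..n. 1 / of_nat i ^ 2) \<approx> 0"
proof -
  have "even (p - 3)" by (simp add: p_eq)
  hence "[2 * (\<Sum>i=1..n. poly (monom 1 (p - 3)) (int i)) = - poly (monom 1 (p - 3)) 0] (mod int p)"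
    using assms by (intro half_sum_poly_cong) (simp_all add: degree_monom_eq poly_monom)
  hence "[2 * (\<Sum>i=1..n. int i ^ (p - 3)) = 0] (mod int p)"
    using assms by (simp add: poly_monom power_0_left)
  from rat_cong_mult_left[OF integral_inverse_2 rat_cong_of_int[OF this]]
  have 1: "(\<Sum>i=1..n. of_nat i ^ (p - 3)) \<approx> 0" by simp
  have 2: "(\<Sum>i=1..n. of_nat i ^ (p - 3)) \<approx> (\<Sum>i=1..n. 1 / of_nat i ^ 2)"
    using assms by (intro rat_cong_sum inverse_square_cong) (auto simp: p_eq)
  from rat_cong_trans[OF rat_cong_sym[OF 2] 1] show ?thesis .
qed

text \<open>After division by \<open>i ^ 2\<close> the coefficient is \<open>2 / (2 k)!\<close>
  times an even polynomial in \<open>i\<close> of degree \<open>2 (k - 1) < p - 1\<close>. Its half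
  sum is determined by its value at \<open>0\<close>, a signed square of
  \<open>(k - 1)!\<close>.\<close>

lemma lucas_coeff_sum_cong:
  assumes "1 \<le> k" "k \<le> n"
  shows "(\<Sum>i=1..n. of_nat (lucas_coeff i k) / of_nat i ^ 2)
     \<approx> (- 1) ^ k / (of_nat k ^ 2 * of_nat (2 * k choose k))"
proof -
  obtain j where k: "k = Suc j" using assms by (cases k) auto
  define f :: "int poly" where "f = (\<Prod>l=1..j. [:- (int l ^ 2), 0, 1:])"
  have f: "poly f x = (\<Prod>l=1..j. x ^ 2 - int l ^ 2)" for x
    by (simp add: f_def poly_prod power2_eq_square)
  have "Polynomial.degree f \<le> (\<Sum>l=1..j. Polynomial.degree [:- (int l ^ 2), 0, 1:])"
    unfolding f_def by (rule degree_prod_sum_le[unfolded comp_def]) simp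
  hence "Polynomial.degree f < p - 1" using assms k p_eq by simp
  hence "[2 * (\<Sum>i=1..n. poly f (int i)) = - poly f 0] (mod int p)"
    by (rule half_sum_poly_cong) (simp add: f)
  hence "[2 * (\<Sum>i=1..n. poly f (int i)) = (- 1) ^ k * fact j ^ 2] (mod int p)"
    using prod_neg_squares[of j] by (simp add: f k)
  from rat_cong_of_int[OF this]
  have "of_int (2 * (\<Sum>i=1..n. poly f (int i))) * (1 / fact (2 * k))
      \<approx> of_int ((- 1) ^ k * fact j ^ 2) * (1 / fact (2 * k))"
  proof (rule rat_cong_mult_right[rotated])
    have "\<not> p dvd fact (2 * k)" using assms p_eq prime by (simp add: prime_dvd_fact_iff)
    from integral_inverse_of_nat[OF this] show "integral (1 / fact (2 * k))" by simp
  qed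
  also have "of_int (2 * (\<Sum>i=1..n. poly f (int i))) * (1 / fact (2 * k))
     = (\<Sum>i=1..n. of_nat (lucas_coeff i k) / of_nat i ^ 2 :: rat)"
  proof -
    have "of_nat (lucas_coeff i k) / of_nat i ^ 2 = 2 * of_int (poly f (int i)) * (1 / fact (2 * k) :: rat)"
      if "i \<in> {1..n}" for i
    proof -
      have "a / b = 2 * q * (1 / c)" if "a * c = 2 * b * q" "b \<noteq> 0" "c \<noteq> 0" for a b c q :: rat
        using that by (simp add: divide_simps mult_ac)
      moreover have "of_nat (lucas_coeff i k) * fact (2 * k) = (2 * of_nat i ^ 2 * of_int (poly f (int i)) :: rat)"
        unfolding k f using that by (intro lucas_coeff_eq_prod) simp
      ultimately show ?thesis using that by simp
    qed
    thus ?thesis by (simp add: sum_distrib_left sum_divide_distrib)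
  qed
  also have "of_int ((- 1) ^ k * fact j ^ 2) * (1 / fact (2 * k))
     = (- 1) ^ k / (of_nat k ^ 2 * of_nat (2 * k choose k) :: rat)"
  proof -
    have "fact k * fact k * (2 * k choose k) = (fact (2 * k) :: nat)"
      using binomial_fact_lemma[of k "2 * k"] by (simp add: mult_2)
    hence "of_nat (fact k * fact k * (2 * k choose k)) = (of_nat (fact (2 * k)) :: rat)"
      by (simp only:)
    hence 1: "fact (2 * k) = (fact k * fact k * of_nat (2 * k choose k) :: rat)"
      by (simp only: of_nat_mult of_nat_fact)
    have 2: "fact k = (of_nat k * fact j :: rat)" by (simp add: k)
    have "fact (2 * k) = (of_nat k ^ 2 * fact j ^ 2 * of_nat (2 * k choose k) :: rat)"
      unfolding 1 2 by (simp only: power2_eq_square mult_ac)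
    thus ?thesis by simp
  qed
  finally show ?thesis .
qed

text \<open>The sum \<open>T y\<close> of the introductory text.\<close>

definition inv_central_sum :: "int \<Rightarrow> rat" where
  "inv_central_sum y = (\<Sum>k=1..n. of_int y ^ k / (of_nat k ^ 2 * of_nat (2 * k choose k)))"

text \<open>Expanding the right side in powers of \<open>- y\<close> and interchanging the sums
  leaves, for each power, a sum over \<open>i\<close> already evaluated modulo
  \<open>p\<close>.\<close>

lemma inv_central_sum_cong:
  assumes "p > 3"
  shows "inv_central_sum y \<approx> (\<Sum>i=1..n. of_int (cheb y (i + 1) - cheb y (i - 1)) / of_nat i ^ 2)"
proof -
  have "(\<Sum>i=1..n. of_int (cheb y (i + 1) - cheb y (i - 1)) / of_nat i ^ 2)
     = (\<Sum>i=1..n. \<Sum>k\<le>n. (- of_int y) ^ k * (of_nat (lucas_coeff i k) / of_nat i ^ 2) :: rat)"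
  proof (intro sum.cong refl)
    fix i assume "i \<in> {1..n}"
    hence "cheb y (i + 1) - cheb y (i - 1) = (\<Sum>k\<le>n. int (lucas_coeff i k) * (- y) ^ k)"
      by (intro cheb_diff) auto
    thus "of_int (cheb y (i + 1) - cheb y (i - 1)) / of_nat i ^ 2
       = (\<Sum>k\<le>n. (- of_int y) ^ k * (of_nat (lucas_coeff i k) / of_nat i ^ 2) :: rat)"
      by (simp only: of_int_sum of_int_mult of_int_of_nat_eq of_int_power of_int_minus
          sum_divide_distrib) (rule sum.cong, simp_all)
  qed
  also have "\<dots> = (\<Sum>k\<le>n. (- of_int y) ^ k * (\<Sum>i=1..n. of_nat (lucas_coeff i k) / of_nat i ^ 2))"
    by (subst sum.swap) (simp add: sum_distrib_left)
  \<comment> \<open>The coefficient for \<open>k = 0\<close> is the constant \<open>2\<close>, which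
    as a polynomial in \<open>i\<close> is not divisible by \<open>i ^ 2\<close>; it leads to the
    sum of inverse squares.\<close>
  also have "\<dots> = 2 * (\<Sum>i=1..n. 1 / of_nat i ^ 2)
      + (\<Sum>k=1..n. (- of_int y) ^ k * (\<Sum>i=1..n. of_nat (lucas_coeff i k) / of_nat i ^ 2))"
  proof -
    have "(\<Sum>k\<le>n. f k) = f 0 + (\<Sum>k=1..n. f k)" for f :: "nat \<Rightarrow> rat"
      using sum.atLeast_Suc_atMost[of 0 n f] by (simp add: atLeast0AtMost)
    thus ?thesis by (simp add: lucas_coeff_0 sum_distrib_left)
  qed
  also have "\<dots> \<approx> 2 * 0 + (\<Sum>k=1..n. (- of_int y) ^ k *
      ((- 1) ^ k / (of_nat k ^ 2 * of_nat (2 * k choose k))))"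
  proof (rule rat_cong_add)
    show "2 * (\<Sum>i=1..n. 1 / of_nat i ^ 2) \<approx> 2 * 0"
      using half_harmonic_squares_cong[OF assms] by (intro rat_cong_mult_left) simp_all
    show "(\<Sum>k=1..n. (- of_int y) ^ k * (\<Sum>i=1..n. of_nat (lucas_coeff i k) / of_nat i ^ 2))
       \<approx> (\<Sum>k=1..n. (- of_int y) ^ k * ((- 1) ^ k / (of_nat k ^ 2 * of_nat (2 * k choose k))))"
    proof (rule rat_cong_sum)
      fix k assume "k \<in> {1..n}"
      thus "(- of_int y) ^ k * (\<Sum>i=1..n. of_nat (lucas_coeff i k) / of_nat i ^ 2)
         \<approx> (- of_int y) ^ k * ((- 1) ^ k / (of_nat k ^ 2 * of_nat (2 * k choose k)))"
        using lucas_coeff_sum_cong[of k] by (intro rat_cong_mult_left) simp_all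
    qed
  qed
  also have "\<dots> = inv_central_sum y"
  proof -
    have "(- of_int y) ^ k * ((- 1) ^ k / c) = of_int y ^ k / c" for k and c :: rat
    proof -
      have "(- of_int y) ^ k * (- 1) ^ k = (of_int y ^ k :: rat)"
        by (simp flip: power_mult_distrib)
      thus ?thesis by simp
    qed
    thus ?thesis unfolding inv_central_sum_def by (simp only:)
  qed
  finally show ?thesis by (rule rat_cong_sym)
qed

end

section \<open>Evaluations at \<open>y = 4\<close> and \<open>y = 1\<close>, and a telescoping
  sum\<close>

lemma cheb_4_diff:
  assumes "i \<ge> 1" shows "cheb 4 (i + 1) - cheb 4 (i - 1) = 2 * (- 1) ^ i"
proof -
  obtain m where "i = Suc m" using assms by (cases i) auto
  thus ?thesis by (simp add: cheb_4 algebra_simps)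
qed

text \<open>Here \<open>u\<close> is a primitive sixth root of unity and the value is
  \<open>2 cos (i pi / 3)\<close>. The induction goes in steps of \<open>3\<close>, under which both
  sides change sign.\<close>

lemma cheb_one_diff:
  assumes "i \<ge> 1"
  shows "cheb 1 (i + 1) - cheb 1 (i - 1) = (- 1) ^ i * (if 3 dvd i then 2 else - 1)"
  using assms
proof (induction i rule: less_induct)
  case (less i)
  have base: "cheb 1 0 = 0" "cheb 1 1 = 1" "cheb 1 2 = 1" "cheb 1 3 = 0" "cheb 1 4 = -1"
    by (simp_all add: cheb_one)
  show ?case
  proof (cases "i \<le> 3")
    case True
    hence "i = 1 \<or> i = 2 \<or> i = 3" using less.prems by auto
    thus ?thesis using base by (auto simp flip: numeral_2_eq_2)
  next
    case False
    define j where "j = i - 3"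
    have j: "i = j + 3" "j \<ge> 1" using False by (auto simp: j_def)
    have "cheb 1 (i + 1) - cheb 1 (i - 1) = - (cheb 1 (j + 1) - cheb 1 (j - 1))"
      using cheb_one_add_3[of "j + 1"] cheb_one_add_3[of "j - 1"] j
      by (simp add: eval_nat_numeral)
    moreover have "3 dvd i \<longleftrightarrow> 3 dvd j" using j by simp
    ultimately show ?thesis using less.IH[of j] j by (simp add: power_add)
  qed
qed

text \<open>The left side is \<open>sin ((2 n + 1) t) / sin t\<close> at \<open>t = pi / 6\<close>;
  the excluded residue class is exactly the one where \<open>3\<close> divides
  \<open>2 n + 1\<close>.\<close>

lemma cheb_one_Suc_add:
  assumes "n mod 3 \<noteq> 1"
  shows "cheb 1 (Suc n) + cheb 1 n = (- 1) ^ n"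
proof -
  define q where "q = n div 3"
  have "n mod 3 < 3" by simp
  with assms have "n mod 3 = 0 \<or> n mod 3 = 2" by auto
  hence "n = 3 * q \<or> n = 3 * q + 2" unfolding q_def by (metis add.right_neutral mult_div_mod_eq)
  thus ?thesis
  proof
    assume n: "n = 3 * q"
    have "Suc n mod 3 = 1" "Suc n div 3 = q" "n mod 3 = 0" using n by presburger+
    moreover have "((- 1) ^ n :: int) = (- 1) ^ q" by (simp add: n power_mult)
    ultimately show ?thesis by (simp add: cheb_one)
  next
    assume n: "n = 3 * q + 2"
    have "Suc n mod 3 = 0" "n div 3 = q" "n mod 3 = 2" using n by presburger+
    moreover have "((- 1) ^ n :: int) = (- 1) ^ q" by (simp add: n power_mult power_add)
    ultimately show ?thesis by (simp add: cheb_one)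
  qed
qed

text \<open>Each term is the increment of \<open>2 * 4 ^ j / (2 j choose j)\<close>, so the sum
  telescopes.\<close>

lemma sum_four_power_div_central_binomial:
  "(\<Sum>j=1..n. 4 ^ j / (of_nat j * of_nat (2 * j choose j)))
     = (2 * (4 ^ n / of_nat (2 * n choose n) - 1) :: rat)"
proof (induction n)
  case (Suc n)
  \<comment> \<open>Here \<open>c\<close> and \<open>c'\<close> stand for consecutive central
    binomial coefficients, \<open>x\<close> for \<open>n + 1\<close> and \<open>a\<close> for
    \<open>4 ^ n\<close>.\<close>
  have "4 * a / (x * c') = 2 * (4 * a / c') - 2 * (a / c)"
    if "c' * x = 2 * (2 * (x - 1) + 1) * c" "x \<noteq> 0" "c \<noteq> 0" "c' \<noteq> 0" for a c c' x :: rat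
  proof -
    have "2 * (4 * a / c') - 2 * (a / c) = (8 * a * c - 2 * a * c') / (c' * c)"
      using that by (simp add: field_simps)
    also have "(8 * a * c - 2 * a * c') / (c' * c) = 4 * a / (x * c')"
    proof (subst frac_eq_eq)
      have "2 * (c' * x) = 8 * x * c - 4 * c" using that(1) by (simp add: algebra_simps)
      moreover have "(8 * a * c - 2 * a * c') * (x * c') = a * c' * (8 * x * c - 2 * (c' * x))"
        by (simp add: algebra_simps)
      ultimately show "(8 * a * c - 2 * a * c') * (x * c') = 4 * a * (c' * c)" by (simp add: mult_ac)
    qed (use that in simp_all)
    finally show ?thesis ..
  qed
  from this[of "of_nat (2 * Suc n choose Suc n)" "of_nat (Suc n)" "of_nat (2 * n choose n)" "4 ^ n"]
  have "4 * 4 ^ n / (of_nat (Suc n) * of_nat (2 * Suc n choose Suc n))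
     = 2 * (4 * 4 ^ n / of_nat (2 * Suc n choose Suc n)) - 2 * (4 ^ n / of_nat (2 * n choose n) :: rat)"
    using central_binomial_Suc[of n] by (simp del: binomial_Suc_Suc mult_Suc_right add: algebra_simps)
  thus ?case using Suc by (simp del: binomial_Suc_Suc mult_Suc_right add: algebra_simps)
qed simp

section \<open>The alternating sum of inverse squares and its Euler number\<close>

context rat_cong_odd_prime
begin

lemma three_not_dvd: "p > 3 \<Longrightarrow> \<not> 3 dvd p"
  using prime primes_dvd_imp_eq[of 3 p] by auto

lemma integral_inverse_3: "p > 3 \<Longrightarrow> integral (1 / 3)"
  using integral_inverse_less[of 3] by simp

text \<open>The sum \<open>S\<close> of the introductory text.\<close>

definition alternating_sum :: rat where
  "alternating_sum = (\<Sum>i=1..n. (- 1) ^ i / of_nat i ^ 2)"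

lemma integral_inverse_square: "i \<in> {1..n} \<Longrightarrow> integral (1 / of_nat i ^ 2)"
  by (intro integral_inverse_power integral_inverse_less) (auto simp: p_eq)

lemma integral_alternating_sum: "integral alternating_sum"
  unfolding alternating_sum_def
  by (rule integral_sum, rule integral_divide) (simp, rule integral_inverse_square)

text \<open>Replace \<open>1 / i ^ 2\<close> by \<open>i ^ (p - 3)\<close>. The alternating power
  sum then involves \<open>euler_poly\<close> at \<open>2 n + 1 = p\<close>, which is the Euler
  number modulo \<open>p\<close>, and the factor \<open>4 * 2 ^ (p - 3) = 4 ^ n\<close> is
  \<open>1\<close> modulo \<open>p\<close>.\<close>

lemma alternating_sum_cong_euler:
  assumes "p > 3"
  shows "alternating_sum \<approx> 2 * (- 1) ^ n * of_int (euler_number (p - 3))"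
proof -
  let ?m = "p - 3"
  define X :: rat where "X = of_int (\<Sum>i=1..n. (- 1) ^ i * int i ^ ?m)"
  have "even ?m" "?m > 0" using assms p_eq by auto
  hence "of_int (2 * 2 ^ ?m * (\<Sum>i=1..n. (- 1) ^ i * int i ^ ?m))
      = (of_int ((- 1) ^ n * euler_poly ?m (2 * int n + 1)) :: rat)"
    by (subst alternating_power_sum) simp_all
  hence 1: "2 * 2 ^ ?m * X = (- 1) ^ n * of_int (euler_poly ?m (int p))"
    unfolding X_def by (simp only: of_int_mult of_int_power of_int_numeral of_int_minus of_int_1)
      (simp add: p_eq add.commute)
  have "2 * n = ?m + 2" using assms p_eq by simp
  hence "(2 :: rat) ^ (2 * n) = 2 ^ ?m * 2 ^ 2" by (simp only: power_add)
  hence 2: "(4 :: rat) ^ n = 4 * 2 ^ ?m" by (simp add: power_mult)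
  have 3: "alternating_sum \<approx> X"
    unfolding alternating_sum_def X_def of_int_sum
  proof (rule rat_cong_sum)
    fix i assume "i \<in> {1..n}"
    hence "0 < i" "i < p" by (auto simp: p_eq)
    hence "(- 1) ^ i * (of_nat i ^ ?m) \<approx> (- 1) ^ i * (1 / of_nat i ^ 2)"
      using assms by (intro rat_cong_mult_left inverse_square_cong) simp_all
    from rat_cong_sym[OF this]
    show "(- 1) ^ i / of_nat i ^ 2 \<approx> of_int ((- 1) ^ i * int i ^ ?m)" by simp
  qed
  have X: "integral X" unfolding X_def by (rule integral_of_int)
  have "X \<approx> 4 ^ n * X"
    using rat_cong_mult_right[OF X rat_cong_sym[OF four_power_n]] by simp
  also have "4 ^ n * X = 2 * (- 1) ^ n * of_int (euler_poly ?m (int p))"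
    unfolding 2 using 1 by (simp add: mult_ac)
  also have "\<dots> \<approx> 2 * (- 1) ^ n * of_int (euler_number ?m)"
    by (intro rat_cong_mult_left rat_cong_of_int euler_poly_cong) simp
  finally have "X \<approx> 2 * (- 1) ^ n * of_int (euler_number ?m)" .
  from rat_cong_trans[OF 3 this] show ?thesis .
qed

section \<open>Multiplication of the summation index by \<open>3\<close>\<close>

definition third_sum :: rat where
  "third_sum = (\<Sum>i=1..n div 3. (- 1) ^ i / of_nat i ^ 2)"

text \<open>The absolute least residue of \<open>3 * i\<close> modulo \<open>p\<close>. It has the parity of \<open>i\<close> if
  \<open>3 * i \<le> n\<close> and the opposite parity otherwise, so permuting the terms of the alternating sum
  by it compares that sum with its first third.\<close>

definition abs_triple :: "nat \<Rightarrow> nat" where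
  "abs_triple i = (if 3 * i \<le> n then 3 * i else if 3 * i \<le> p then p - 3 * i else 3 * i - p)"

text \<open>Equal values of \<open>abs_triple\<close> force \<open>p\<close> to divide
  \<open>3 (i - j)\<close> or \<open>3 (i + j)\<close>; as \<open>p > 3\<close>, it divides
  \<open>i - j\<close> or \<open>i + j\<close>, both smaller than \<open>p\<close> in absolute
  value. Surjectivity follows by finiteness.\<close>

lemma abs_triple_image:
  assumes "p > 3"
  shows "inj_on abs_triple {1..n}" "abs_triple ` {1..n} = {1..n}"
proof -
  have dvd: "int p dvd int (abs_triple i) - 3 * int i \<or> int p dvd int (abs_triple i) + 3 * int i" for i
    unfolding abs_triple_def by (auto simp: of_nat_diff)
  have cancel: "x = 0" if "int p dvd 3 * x" "\<bar>x\<bar> < int p" for x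
  proof -
    have "\<not> int p dvd 3"
      using assms not_dvd_between[of 3] int_dvd_int_iff[of p 3] by simp
    hence "int p dvd x" using that(1) prime by (simp add: prime_dvd_mult_iff)
    thus ?thesis using that(2) dvd_imp_le_int[of x "int p"] by force
  qed
  show inj: "inj_on abs_triple {1..n}"
  proof
    fix i j assume ij: "i \<in> {1..n}" "j \<in> {1..n}" and eq: "abs_triple i = abs_triple j"
    have "int p dvd 3 * (int i - int j) \<or> int p dvd 3 * (int i + int j)"
    proof -
      define a where "a = int (abs_triple i)"
      have "int p dvd a - 3 * int i \<or> int p dvd a + 3 * int i"
        "int p dvd a - 3 * int j \<or> int p dvd a + 3 * int j"
        using dvd[of i] dvd[of j] eq by (simp_all add: a_def)
      note dvd_a = this
      have "3 * (int i - int j) = (a - 3 * int j) - (a - 3 * int i)"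
        "3 * (int i - int j) = (a + 3 * int i) - (a + 3 * int j)"
        "3 * (int i + int j) = (a + 3 * int i) - (a - 3 * int j)"
        "3 * (int i + int j) = (a + 3 * int j) - (a - 3 * int i)" by simp_all
      note eqs = this
      have "int p dvd 3 * (int i - int j)" if "int p dvd a - 3 * int i" "int p dvd a - 3 * int j"
        unfolding eqs(1) by (rule dvd_diff[OF that(2) that(1)])
      moreover have "int p dvd 3 * (int i - int j)" if "int p dvd a + 3 * int i" "int p dvd a + 3 * int j"
        unfolding eqs(2) by (rule dvd_diff[OF that(1) that(2)])
      moreover have "int p dvd 3 * (int i + int j)" if "int p dvd a + 3 * int i" "int p dvd a - 3 * int j"
        unfolding eqs(3) by (rule dvd_diff[OF that(1) that(2)])
      moreover have "int p dvd 3 * (int i + int j)" if "int p dvd a - 3 * int i" "int p dvd a + 3 * int j"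
        unfolding eqs(4) by (rule dvd_diff[OF that(2) that(1)])
      ultimately show ?thesis using dvd_a by blast
    qed
    thus "i = j"
    proof
      assume "int p dvd 3 * (int i - int j)"
      moreover have "\<bar>int i - int j\<bar> < int p" using ij p_eq by auto
      ultimately show ?thesis using cancel[of "int i - int j"] by simp
    next
      assume "int p dvd 3 * (int i + int j)"
      moreover have "\<bar>int i + int j\<bar> < int p" using ij p_eq by auto
      ultimately show ?thesis using cancel[of "int i + int j"] ij by simp
    qed
  qed
  have "abs_triple i \<in> {1..n}" if "i \<in> {1..n}" for i
  proof -
    \<comment> \<open>If \<open>3 * i = p\<close>, the value would be \<open>0\<close>, outside the
      index range.\<close>
    have "3 * i \<noteq> p" using three_not_dvd[OF assms] by (metis dvd_triv_left)
    thus ?thesis using that unfolding abs_triple_def by (auto simp: p_eq)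
  qed
  thus "abs_triple ` {1..n} = {1..n}"
    by (intro endo_inj_surj inj) auto
qed

lemma alternating_abs_triple_cong:
  assumes "p > 3" "i \<in> {1..n}"
  shows "(- 1) ^ abs_triple i / of_nat (abs_triple i) ^ 2
     \<approx> (if 3 * i \<le> n then 1 / 9 else - (1 / 9)) * ((- 1) ^ i / of_nat i ^ 2)"
proof (cases "3 * i \<le> n")
  case True
  have "integral (1 / 9 * ((- 1) ^ i / of_nat i ^ 2))"
    using integral_inverse_power[OF integral_inverse_3[OF assms(1)], of 2]
      integral_inverse_square[OF assms(2)]
    by (intro integral_mult integral_divide[of "(- 1) ^ i"]) simp_all
  moreover have "((- 1) ^ (3 * i) :: rat) = (- 1) ^ i" by (simp add: power_mult)
  ultimately show ?thesis using True by (simp add: abs_triple_def power_mult_distrib rat_cong_refl)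
next
  case False
  let ?a = "of_nat (abs_triple i) :: rat"
  have a: "?a = of_nat p - 3 * of_nat i \<or> ?a = 3 * of_nat i - of_nat p"
    using False unfolding abs_triple_def by (auto simp: of_nat_diff)
  \<comment> \<open>Squaring removes the sign between the two cases; the exact expansion exhibits
    the cofactor of \<open>p\<close>.\<close>
  hence "?a ^ 2 = (3 * of_nat i) ^ 2 + of_nat p * (of_nat p - 6 * of_nat i)"
    by (elim disjE) (erule ssubst, simp add: power2_eq_square algebra_simps)+
  hence sq: "?a ^ 2 \<approx> (3 * of_nat i) ^ 2"
    by (intro rat_congI[of _ "of_nat p - 6 * of_nat i"])
      (simp_all only: integral_power integral_mult integral_diff integral_numeral integral_of_nat power_Suc power_0 mult_1_right)
  have ai: "abs_triple i \<in> {1..n}" using abs_triple_image(2)[OF assms(1)] assms(2) by blast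
  have "integral (1 / (3 * of_nat i))"
    using assms by (intro integral_inverse_mult integral_inverse_3 integral_inverse_less)
      (auto simp: p_eq)
  hence "(- 1) ^ abs_triple i / ?a ^ 2 \<approx> (- 1) ^ abs_triple i / (3 * of_nat i) ^ 2"
    using ai assms(2)
    by (intro rat_cong_divide sq rat_cong_refl integral_inverse_square integral_inverse_power) simp_all
  moreover have "even (abs_triple i) \<longleftrightarrow> odd i"
    using False p_eq unfolding abs_triple_def by auto
  hence "((- 1) ^ abs_triple i :: rat) = - ((- 1) ^ i)" by (cases "even i") auto
  ultimately show ?thesis using False by (simp add: power_mult_distrib)
qed

text \<open>With \<open>S\<close> the alternating sum and \<open>R\<close> its first third, the
  permutation gives \<open>S \<equiv> R / 9 - (S - R) / 9\<close>, which is solved for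
  \<open>R\<close>.\<close>

lemma third_sum_cong:
  assumes "p > 3" shows "third_sum \<approx> 5 * alternating_sum"
proof -
  define f :: "nat \<Rightarrow> rat" where "f i = (- 1) ^ i / of_nat i ^ 2" for i
  have S: "alternating_sum = sum f {1..n}" by (simp add: alternating_sum_def f_def)
  have int9: "integral (1 / 9)"
    using integral_inverse_power[OF integral_inverse_3[OF assms(1)], of 2] by simp
  have "sum f {1..n} = (\<Sum>i=1..n. f (abs_triple i))"
    using sum.reindex[OF abs_triple_image(1)[OF assms], of f] abs_triple_image(2)[OF assms]
    by (simp add: comp_def)
  also have "\<dots> \<approx> (\<Sum>i=1..n. (if 3 * i \<le> n then 1 / 9 else - (1 / 9)) * f i)"
    unfolding f_def by (intro rat_cong_sum alternating_abs_triple_cong assms)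
  also have "(\<Sum>i=1..n. (if 3 * i \<le> n then 1 / 9 else - (1 / 9)) * f i)
     = (\<Sum>i=1..n. 2 / 9 * (if 3 * i \<le> n then f i else 0) - 1 / 9 * f i)"
    by (intro sum.cong) (auto simp: field_simps)
  also have "\<dots> = 2 / 9 * (\<Sum>i=1..n. if 3 * i \<le> n then f i else 0) - 1 / 9 * sum f {1..n}"
    by (simp only: sum_subtractf sum_distrib_left)
  also have "(\<Sum>i=1..n. if 3 * i \<le> n then f i else 0) = sum f {i\<in>{1..n}. 3 * i \<le> n}"
    by (simp only: sum.inter_filter finite_atLeastAtMost)
  also have "{i\<in>{1..n}. 3 * i \<le> n} = {1..n div 3}" by auto
  also have "sum f {1..n div 3} = third_sum" by (simp add: third_sum_def f_def)
  finally have "alternating_sum \<approx> 2 / 9 * third_sum - 1 / 9 * alternating_sum"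
    unfolding S .
  \<comment> \<open>The factor \<open>9 / 2\<close> isolates \<open>third_sum\<close>; it is
    integral since \<open>p\<close> is odd.\<close>
  from rat_cong_mult_left[OF _ this, of "9 * (1 / 2)"]
  have "9 / 2 * alternating_sum \<approx> third_sum - 1 / 2 * alternating_sum"
    using integral_inverse_2 integral_mult[of 9 "1/2"] by (simp add: algebra_simps)
  from rat_cong_add[OF this rat_cong_refl[of "1 / 2 * alternating_sum"]]
  have "5 * alternating_sum \<approx> third_sum"
    using integral_mult[OF integral_inverse_2 integral_alternating_sum]
    by (simp add: algebra_simps flip: distrib_left)
  thus ?thesis by (rule rat_cong_sym)
qed

lemma inv_central_sum_4:
  assumes "p > 3" shows "inv_central_sum 4 \<approx> 2 * alternating_sum"
proof -
  have "(\<Sum>i=1..n. of_int (cheb 4 (i + 1) - cheb 4 (i - 1)) / of_nat i ^ 2 :: rat) = 2 * alternating_sum"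
    unfolding alternating_sum_def sum_distrib_left
    by (intro sum.cong refl) (subst cheb_4_diff, simp_all)
  thus ?thesis using inv_central_sum_cong[OF assms, of 4] by simp
qed

text \<open>The sixth-root values give three times the part of the alternating sum over multiples of
  \<open>3\<close>, minus the whole. That part is \<open>third_sum / 9\<close>, so the result is
  \<open>5 / 3 - 1 = 2 / 3\<close> times the alternating sum.\<close>

lemma inv_central_sum_1:
  assumes "p > 3" shows "inv_central_sum 1 \<approx> 2 / 3 * alternating_sum"
proof -
  define f :: "nat \<Rightarrow> rat" where "f i = (- 1) ^ i / of_nat i ^ 2" for i
  have "(\<Sum>i=1..n. of_int (cheb 1 (i + 1) - cheb 1 (i - 1)) / of_nat i ^ 2 :: rat)
     = (\<Sum>i=1..n. 3 * (if 3 dvd i then f i else 0) - f i)"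
    by (intro sum.cong refl) (subst cheb_one_diff, simp_all add: f_def)
  also have "\<dots> = 3 * (\<Sum>i=1..n. if 3 dvd i then f i else 0) - sum f {1..n}"
    by (simp only: sum_subtractf sum_distrib_left)
  also have "(\<Sum>i=1..n. if 3 dvd i then f i else 0) = sum f {i\<in>{1..n}. 3 dvd i}"
    by (simp only: sum.inter_filter finite_atLeastAtMost)
  also have "{i\<in>{1..n}. 3 dvd i} = (\<lambda>i. 3 * i) ` {1..n div 3}" by (auto elim!: dvdE)
  also have "sum f \<dots> = (\<Sum>i=1..n div 3. f (3 * i))"
    by (subst sum.reindex) (auto simp: inj_on_def)
  also have "\<dots> = 1 / 9 * third_sum"
  proof -
    have "f (3 * i) = 1 / 9 * f i" for i
      by (simp add: f_def power_mult power_mult_distrib)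
    thus ?thesis by (simp only: third_sum_def f_def[symmetric] sum_distrib_left)
  qed
  also have "sum f {1..n} = alternating_sum" by (simp add: alternating_sum_def f_def)
  finally have "inv_central_sum 1 \<approx> 1 / 3 * third_sum - alternating_sum"
    using inv_central_sum_cong[OF assms, of 1] by simp
  also have "\<dots> \<approx> 1 / 3 * (5 * alternating_sum) - alternating_sum"
    using assms by (intro rat_cong_diff rat_cong_mult_left third_sum_cong rat_cong_refl
        integral_alternating_sum integral_inverse_3)
  finally show ?thesis by simp
qed

section \<open>The terms with \<open>k > n\<close>\<close>

lemma rat_cong_p_add: "integral x \<Longrightarrow> of_nat p + x \<approx> x"
  by (rule rat_congI[of _ 1]) simp_all

lemma rat_cong_p_diff: "integral x \<Longrightarrow> of_nat p - x \<approx> - x"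
  by (rule rat_congI[of _ 1]) simp_all

lemma integral_inverse_between:
  "p < k \<Longrightarrow> k < 2 * p \<Longrightarrow> integral (1 / of_nat k)"
proof (rule integral_inverse_of_nat, rule notI)
  assume k: "p < k" "k < 2 * p" and "p dvd k"
  then obtain c where "k = p * c" by (auto elim: dvdE)
  hence "p * 1 < p * c" "p * c < p * 2" using k by simp_all
  hence "1 < c" "c < 2" by simp_all
  thus False by simp
qed

text \<open>Induction from \<open>m = 1\<close>: passing to \<open>m + 1\<close> multiplies the left
  side by \<open>4 (p + 2 m) / (p + 2 m + 1)\<close> and the right side by
  \<open>4 (2 m) / (2 m + 1)\<close>, which agree modulo \<open>p\<close>.\<close>

lemma upper_central_binomial_cong:
  assumes "1 \<le> m" "m \<le> n"
  shows "of_nat (2 * (n + m) choose (n + m)) / of_nat p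
    \<approx> (- 1) ^ n * (16 ^ m / (2 * of_nat m * of_nat (2 * m choose m)))"
  using assms
proof (induction m rule: nat_induct_at_least)
  case base
  have "of_nat (2 * Suc n choose Suc n) * (of_nat n + 1) = 2 * of_nat p * (of_nat (2 * n choose n) :: rat)"
    using central_binomial_Suc[of n] by (simp only: of_nat_p)
  moreover have "2 * (of_nat n + 1) = (of_nat p + 1 :: rat)" by (simp add: of_nat_p)
  moreover have "a / q = 4 * b / (q + 1)"
    if "a * x = 2 * q * b" "2 * x = q + 1" "q \<noteq> 0" "q + 1 \<noteq> 0" for a b q x :: rat
  proof -
    have "a * (q + 1) = 4 * b * q" using that(1) unfolding that(2)[symmetric] by simp
    thus ?thesis using that(3,4) by (simp add: frac_eq_eq)
  qed
  moreover have "of_nat p + 1 \<noteq> (0 :: rat)" using of_nat_neq_0[of p, where ?'a = rat] by (simp add: add.commute)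
  ultimately have "of_nat (2 * Suc n choose Suc n) / of_nat p = 4 * of_nat (2 * n choose n) / (of_nat p + 1 :: rat)"
    by simp
  also have "\<dots> \<approx> 4 * (- 1) ^ n / 1"
  proof (rule rat_cong_divide)
    show "4 * of_nat (2 * n choose n) \<approx> 4 * (- 1) ^ n"
      by (intro rat_cong_mult_left central_binomial_n) simp
    show "integral (1 / (of_nat p + 1))"
      using integral_inverse_between[of "p + 1"] n_pos by (simp add: p_eq add.commute)
  qed (use rat_cong_p_add[of 1] \<open>of_nat p + 1 \<noteq> (0 :: rat)\<close> in simp_all)
  finally show ?case by (simp add: mult.commute)
next
  case (Suc m)
  define C where "C k = (of_nat (2 * k choose k) :: rat)" for k
  define x where "x = (of_nat m :: rat)"
  have nz: "x \<noteq> 0" "2 * x + 1 \<noteq> 0" "x + 1 \<noteq> 0" "of_nat p + 2 * x + 1 \<noteq> 0" "of_nat p \<noteq> (0 :: rat)"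
    using Suc.hyps of_nat_neq_0[of "2 * m", where ?'a = rat] of_nat_neq_0[of m, where ?'a = rat]
      of_nat_neq_0[of "p + 2 * m", where ?'a = rat]
    by (simp_all add: x_def algebra_simps)
  have C: "C (Suc k) * (of_nat k + 1) = 2 * (2 * of_nat k + 1) * C k" "C k \<noteq> 0" for k
    using central_binomial_Suc[of k] by (simp_all only: C_def) simp
  have "C (n + Suc m) * (of_nat n + x + 1) = 2 * (of_nat p + 2 * x) * C (n + m)"
    using C(1)[of "n + m"] by (simp add: x_def of_nat_p algebra_simps)
  hence "C (n + Suc m) * (of_nat p + 2 * x + 1) = 4 * (of_nat p + 2 * x) * C (n + m)"
    by (simp add: of_nat_p algebra_simps)
  hence eq1: "C (n + Suc m) / of_nat p
     = C (n + m) / of_nat p * (4 * (of_nat p + 2 * x) / (of_nat p + 2 * x + 1))"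
    using nz by (simp add: divide_simps) (use prime in \<open>auto simp: mult_ac\<close>)
  have eq2: "16 ^ Suc m / (2 * of_nat (Suc m) * C (Suc m))
     = 16 ^ m / (2 * x * C m) * (4 * (2 * x) / (2 * x + 1))"
  proof -
    have "16 * a / (2 * y * c') = a / (2 * x * c) * (4 * (2 * x) / (2 * x + 1))"
      if "c' * y = 2 * (2 * x + 1) * c" "c \<noteq> 0" for a c c' y
    proof -
      have A: "16 * a / (2 * y * c') = 16 * a / (2 * (2 * (2 * x + 1) * c))"
        unfolding that(1)[symmetric] by (simp add: mult_ac)
      have B: "16 * a / (2 * (2 * s * c)) = a / (2 * x * c) * (4 * (2 * x) / s)" if "s \<noteq> 0" for s
        using that nz(1) \<open>c \<noteq> 0\<close> by simp
      show ?thesis unfolding A by (rule B[OF nz(2)])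
    qed
    from this[of "C (Suc m)" "of_nat (Suc m)" "C m" "16 ^ m"] C[of m] show ?thesis
      by (simp add: x_def add.commute)
  qed
  have "4 * (of_nat p + 2 * x) / (of_nat p + 2 * x + 1) \<approx> 4 * (2 * x) / (2 * x + 1)"
  proof (rule rat_cong_divide)
    have "integral x" by (simp add: x_def)
    thus "4 * (of_nat p + 2 * x) \<approx> 4 * (2 * x)" "of_nat p + 2 * x + 1 \<approx> 2 * x + 1"
      using rat_cong_p_add[of "2 * x + 1"]
      by (intro rat_cong_mult_left rat_cong_p_add, simp_all add: add.assoc)
    show "integral (1 / (of_nat p + 2 * x + 1))" "integral (1 / (2 * x + 1))"
      using integral_inverse_between[of "p + 2 * m + 1"] integral_inverse_less[of "2 * m + 1"]
        Suc.prems unfolding x_def by (simp_all add: p_eq add_ac)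
  qed (use nz in simp_all)
  moreover have "C (n + m) / of_nat p \<approx> (- 1) ^ n * (16 ^ m / (2 * x * C m))"
    using Suc by (simp add: C_def x_def)
  ultimately have "C (n + Suc m) / of_nat p \<approx> (- 1) ^ n * (16 ^ Suc m / (2 * of_nat (Suc m) * C (Suc m)))"
    unfolding eq1 eq2 mult.assoc[symmetric, of "(- 1) ^ n"] by (intro rat_cong_mult)
  thus ?case by (simp only: C_def)
qed

text \<open>For \<open>k = n + m\<close> the central binomial coefficient contributes the factor
  \<open>p\<close>, while \<open>2 k + 1 = p + 2 m\<close> is a unit. So the cofactor only has to be
  reduced modulo \<open>p\<close>, where \<open>16 ^ n\<close> becomes \<open>1\<close>.\<close>

lemma upper_sum_cong:
  "rat_cong p 2
     (\<Sum>k | p < 2 * k \<and> k < p. of_nat (2 * k choose k) * (of_int y / 16) ^ k / (2 * of_nat k + 1))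
     (of_nat p * ((- 1) ^ n * of_int y ^ n / 4 * inv_central_sum y))"
proof -
  let ?y = "of_int y :: rat"
  define D where "D m = (of_nat (2 * (n + m) choose (n + m)) / of_nat p :: rat)" for m
  have 4: "integral (1 / 4)" "integral (1 / 16 ^ k)" for k
    using integral_inverse_power_2(1)[of 1] integral_inverse_power_2(2) by simp_all
  have yk: "integral ((?y / 16) ^ k)" for k
    using integral_mult[of "?y ^ k" "1 / 16 ^ k"] 4(2) by (simp add: power_divide)
  have "(\<Sum>k | p < 2 * k \<and> k < p. of_nat (2 * k choose k) * (?y / 16) ^ k / (2 * of_nat k + 1))
     = (\<Sum>m=1..n. of_nat (2 * (n + m) choose (n + m)) * (?y / 16) ^ (n + m) / (2 * of_nat (n + m) + 1))"
    by (rule sum.reindex_bij_witness[where i = "\<lambda>m. n + m" and j = "\<lambda>k. k - n"]) (auto simp: p_eq)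
  also have "\<dots> = of_nat p * (\<Sum>m=1..n. D m * (?y / 16) ^ (n + m) * (1 / (of_nat p + 2 * of_nat m)))"
    unfolding sum_distrib_left
  proof (intro sum.cong refl)
    fix m
    have "2 * of_nat (n + m) + 1 = (of_nat p + 2 * of_nat m :: rat)" by (simp add: of_nat_p)
    thus "of_nat (2 * (n + m) choose (n + m)) * (?y / 16) ^ (n + m) / (2 * of_nat (n + m) + 1)
       = of_nat p * (D m * (?y / 16) ^ (n + m) * (1 / (of_nat p + 2 * of_nat m)))"
      by (simp add: D_def)
  qed
  finally have sum_eq: "(\<Sum>k | p < 2 * k \<and> k < p. of_nat (2 * k choose k) * (?y / 16) ^ k / (2 * of_nat k + 1))
    = of_nat p * (\<Sum>m=1..n. D m * (?y / 16) ^ (n + m) * (1 / (of_nat p + 2 * of_nat m)))" .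
  have "(\<Sum>m=1..n. D m * (?y / 16) ^ (n + m) * (1 / (of_nat p + 2 * of_nat m)))
     \<approx> (\<Sum>m=1..n. (- 1) ^ n * (16 ^ m / (2 * of_nat m * of_nat (2 * m choose m)))
            * (?y ^ n * (?y / 16) ^ m) * (1 / (2 * of_nat m)))"
  proof (rule rat_cong_sum)
    fix m assume m: "m \<in> {1..n}"
    have "1 / 16 ^ n \<approx> 1 / 1"
      by (rule rat_cong_divide[OF rat_cong_refl sixteen_power_n]) (simp_all add: 4)
    moreover have "integral (?y ^ n * (?y / 16) ^ m)" by (intro integral_mult yk) simp
    ultimately have "?y ^ n * (?y / 16) ^ m * (1 / 16 ^ n) \<approx> ?y ^ n * (?y / 16) ^ m * (1 / 1)"
      by (intro rat_cong_mult_left)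
    hence"(?y / 16) ^ (n + m) \<approx> ?y ^ n * (?y / 16) ^ m"
      by (simp add: power_add power_divide mult_ac)
    moreover have "1 / (of_nat p + 2 * of_nat m) \<approx> 1 / (2 * of_nat m)"
    proof (rule rat_cong_divide)
      show "integral (1 / (of_nat p + 2 * of_nat m))" "integral (1 / (2 * of_nat m))"
        using integral_inverse_between[of "p + 2 * m"] integral_inverse_less[of "2 * m"] m
        by (simp_all add: p_eq add_ac)
      have "of_nat (p + 2 * m) \<noteq> (0 :: rat)" using m unfolding of_nat_eq_0_iff by simp
      thus "of_nat p + 2 * of_nat m \<noteq> (0 :: rat)" by simp
    qed (use m in \<open>simp_all add: rat_cong_refl rat_cong_p_add\<close>)
    ultimately show "D m * (?y / 16) ^ (n + m) * (1 / (of_nat p + 2 * of_nat m))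
      \<approx> (- 1) ^ n * (16 ^ m / (2 * of_nat m * of_nat (2 * m choose m)))
            * (?y ^ n * (?y / 16) ^ m) * (1 / (2 * of_nat m))"
      unfolding D_def using m by (intro rat_cong_mult upper_central_binomial_cong) simp_all
  qed
  also have "\<dots> = (- 1) ^ n * ?y ^ n / 4 * inv_central_sum y"
    unfolding inv_central_sum_def sum_distrib_left
    by (intro sum.cong refl) (simp add: power_divide power2_eq_square mult_ac)
  finally have "rat_cong p (Suc (Suc 0))
    (of_nat p * (\<Sum>m=1..n. D m * (?y / 16) ^ (n + m) * (1 / (of_nat p + 2 * of_nat m))))
    (of_nat p * ((- 1) ^ n * ?y ^ n / 4 * inv_central_sum y))"
    by (rule rat_cong_p_mult)
  thus ?thesis unfolding sum_eq by (simp only: numeral_2_eq_2)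
qed

section \<open>Sums with inverse central binomial coefficients\<close>

definition reflected_term :: "nat \<Rightarrow> rat" where
  "reflected_term j = 16 ^ j / (of_nat j * (2 * of_nat j - 1) * of_nat (2 * j choose j))"

text \<open>The reflection \<open>j = n + 1 - m\<close> turns these terms into those of
  \<open>inv_central_sum\<close>. The induction on \<open>m\<close> lowers \<open>j\<close> by one
  at a time and compares ratios of consecutive terms modulo \<open>p\<close>.\<close>

lemma reflected_term_cong:
  assumes "1 \<le> m" "m \<le> n"
  shows "reflected_term (n + 1 - m) \<approx> (- 1) ^ n * (2 / (of_nat m ^ 2 * of_nat (2 * m choose m)))"
  using assms
proof (induction m rule: nat_induct_at_least)
  case base
  have n1: "2 * of_nat n - 1 = (of_nat (2 * n - 1) :: rat)" using n_pos by (simp add: of_nat_diff)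
  have "0 < n" "n < p" "0 < 2 * n - 1" "2 * n - 1 < p" using n_pos p_eq by simp_all
  hence "integral (1 / of_nat n)" "integral (1 / of_nat (2 * n - 1))"
    by (simp_all only: integral_inverse_less)
  hence int: "integral (1 / (of_nat n * (2 * of_nat n - 1) * of_nat (2 * n choose n)))"
    unfolding n1
    by (intro integral_inverse_mult integral_inverse_central_binomial[OF order.refl])
  have "of_nat (2 * n - 1) \<noteq> (0 :: rat)" using n_pos unfolding of_nat_eq_0_iff by simp
  hence ne: "of_nat n * (2 * of_nat n - 1) * of_nat (2 * n choose n) \<noteq> (0 :: rat)"
    unfolding n1 using n_pos by simp
  have minus: "1 / (- 1) ^ n = ((- 1) ^ n :: rat)" by (cases "even n") simp_all
  \<comment> \<open>Exactly, \<open>n (2 n - 1) = 1 + (2 n + 1) (n - 1)\<close>.\<close>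
  have "of_nat n * (2 * of_nat n - 1) \<approx> 1"
    by (rule rat_congI[of _ "of_nat n - 1"]) (simp_all add: of_nat_p algebra_simps)
  from rat_cong_mult[OF this central_binomial_n]
  have "of_nat n * (2 * of_nat n - 1) * of_nat (2 * n choose n) \<approx> (- 1) ^ n" by simp
  moreover have "integral (1 / (- 1) ^ n)" unfolding minus by simp
  moreover have "((- 1) ^ n :: rat) \<noteq> 0" by simp
  ultimately have "reflected_term n \<approx> 1 / (- 1) ^ n"
    unfolding reflected_term_def by (intro rat_cong_divide sixteen_power_n ne int)
  thus ?case unfolding minus by simp
next
  case (Suc m)
  define x where "x = (of_nat m :: rat)"
  define j where "j = n - m"
  define C where "C k = (of_nat (2 * k choose k) :: rat)" for k
  have j: "n + 1 - m = Suc j" "n + 1 - Suc m = j" "j \<ge> 1" using Suc.prems by (auto simp: j_def)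
  have 2: "2 * of_nat j = of_nat p - (2 * x + 1)"
    using Suc.prems by (simp add: j_def of_nat_diff x_def of_nat_p)
  have C: "C (Suc k) * (of_nat k + 1) = 2 * (2 * of_nat k + 1) * C k" "C k \<noteq> 0" for k
    using central_binomial_Suc[of k] by (simp_all only: C_def) simp
  have "2 * of_nat j - 1 = (of_nat (2 * j - 1) :: rat)" using j(3) by (simp add: of_nat_diff)
  moreover have "of_nat (2 * j - 1) \<noteq> (0 :: rat)" using j(3) unfolding of_nat_eq_0_iff by simp
  ultimately have jne: "of_nat j \<noteq> (0 :: rat)" "2 * of_nat j - 1 \<noteq> (0 :: rat)"
      "2 * of_nat j + 1 \<noteq> (0 :: rat)" "of_nat j + 1 \<noteq> (0 :: rat)"
    using j(3) of_nat_neq_0[of "2 * j", where ?'a = rat] of_nat_neq_0[of j, where ?'a = rat]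
    by (simp_all add: add.commute)
  \<comment> \<open>With \<open>t = j\<close> this is the ratio of the terms at \<open>j\<close> and
    \<open>j + 1\<close>. It is written in \<open>2 t\<close> and \<open>2 t \<plusminus> 1\<close>
    because \<open>2 j + 1\<close>, \<open>2 j\<close>, \<open>2 j - 1\<close> are
    \<open>- 2 x\<close>, \<open>- (2 x + 1)\<close>, \<open>- (2 x + 2)\<close> modulo
    \<open>p\<close>.\<close>
  have ratio: "a / (t * (2 * t - 1) * c)
       = 16 * a / ((t + 1) * (2 * (t + 1) - 1) * c') * ((2 * t + 1) ^ 2 / (4 * (2 * t * (2 * t - 1))))"
    if "c' * (t + 1) = 2 * (2 * t + 1) * c" "t \<noteq> 0" "2 * t - 1 \<noteq> 0" "2 * t + 1 \<noteq> 0" "c \<noteq> 0"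
    for a c c' t :: rat
  proof -
    have "(t + 1) * (2 * (t + 1) - 1) * c' = (2 * t + 1) * (c' * (t + 1))"
      by (simp add: algebra_simps)
    hence *: "(t + 1) * (2 * (t + 1) - 1) * c' = (2 * t + 1) * (2 * (2 * t + 1) * c)"
      unfolding that(1) .
    have "16 * a / (s * (2 * s * c)) * (s ^ 2 / (4 * (2 * t * r))) = a / (t * r * c)"
      if "s \<noteq> 0" for r s :: rat
      using that by (simp add: power2_eq_square)
    from this[OF that(4), symmetric] show ?thesis unfolding * .
  qed
  have eq1: "reflected_term j = reflected_term (Suc j)
      * ((2 * of_nat j + 1) ^ 2 / (4 * (2 * of_nat j * (2 * of_nat j - 1))))"
    using ratio[OF C(1)[of j] jne(1-3) C(2)[of j], of "16 ^ j"]
    unfolding reflected_term_def C_def by (simp only: power_Suc of_nat_Suc add.commute)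
  have xne: "x \<noteq> 0" "2 * x + 1 \<noteq> 0" "x + 1 \<noteq> 0" "2 * x + 2 \<noteq> 0"
    using Suc.hyps of_nat_neq_0[of "2 * m", where ?'a = rat] of_nat_neq_0[of m, where ?'a = rat]
      of_nat_neq_0[of "2 * m + 1", where ?'a = rat]
    by (simp_all add: x_def algebra_simps)
  have eq2: "2 / (of_nat (Suc m) ^ 2 * C (Suc m))
     = 2 / (x ^ 2 * C m) * ((2 * x) ^ 2 / (4 * ((2 * x + 1) * (2 * x + 2))))"
  proof -
    have "2 / (y ^ 2 * c') = 2 / (x ^ 2 * c) * ((2 * x) ^ 2 / (4 * ((2 * x + 1) * (2 * y))))"
      if "c' * y = 2 * (2 * x + 1) * c" "c \<noteq> 0" "y \<noteq> 0" for c c' y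
    proof -
      have "y ^ 2 * c' = y * (c' * y)" by (simp add: power2_eq_square)
      thus ?thesis unfolding that(1) using xne that(2,3) by (simp add: divide_simps power2_eq_square)
    qed
    from this[OF C(1)[of m, folded x_def] C(2)[of m]] show ?thesis
      using xne by (simp add: x_def add.commute)
  qed
  have "(2 * of_nat j + 1) ^ 2 / (4 * (2 * of_nat j * (2 * of_nat j - 1)))
      \<approx> (- (2 * x)) ^ 2 / (4 * (- (2 * x + 1) * - (2 * x + 2)))"
  proof (rule rat_cong_divide)
    have x: "integral x" by (simp add: x_def)
    have 3: "2 * of_nat j + 1 = of_nat p - 2 * x" "2 * of_nat j - 1 = of_nat p - (2 * x + 2)"
      using 2 by simp_all
    have *: "2 * of_nat j + 1 \<approx> - (2 * x)" "2 * of_nat j - 1 \<approx> - (2 * x + 2)"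
      "2 * of_nat j \<approx> - (2 * x + 1)"
      unfolding 3 unfolding 2 using x by (intro rat_cong_p_diff; simp)+
    show "(2 * of_nat j + 1) ^ 2 \<approx> (- (2 * x)) ^ 2"
      by (intro rat_cong_power *)
    show "4 * (2 * of_nat j * (2 * of_nat j - 1)) \<approx> 4 * (- (2 * x + 1) * - (2 * x + 2))"
      by (rule rat_cong_mult_left[OF _ rat_cong_mult[OF *(3,2)]]) simp
    have "j + m = n" using Suc.prems by (simp add: j_def)
    hence *: "2 * j < p" "2 * m + 2 < p" using j(3) p_eq by simp_all
    have "integral (1 / of_nat (4 :: nat))" using integral_inverse_power_2(1)[of 1] by simp
    moreover have "integral (1 / of_nat (2 * j))" "integral (1 / of_nat (2 * j - 1))"
      "integral (1 / of_nat (2 * m + 1))" "integral (1 / of_nat (2 * m + 2))"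
      using * j(3) by (intro integral_inverse_less; simp)+
    ultimately have "integral (1 / (of_nat 4 * (of_nat (2 * j) * of_nat (2 * j - 1))))"
      "integral (1 / (of_nat 4 * (of_nat (2 * m + 1) * of_nat (2 * m + 2))))"
      by (intro integral_inverse_mult; simp)+
    thus "integral (1 / (4 * (2 * of_nat j * (2 * of_nat j - 1))))"
      "integral (1 / (4 * (- (2 * x + 1) * - (2 * x + 2))))"
      unfolding minus_mult_minus using j(3) by (simp_all add: of_nat_diff x_def add.commute)
  qed (use jne xne in simp_all)
  also have "(- (2 * x)) ^ 2 / (4 * (- (2 * x + 1) * - (2 * x + 2)))
      = (2 * x) ^ 2 / (4 * ((2 * x + 1) * (2 * x + 2)))" by (simp only: power2_minus minus_mult_minus)
  finally have "(2 * of_nat j + 1) ^ 2 / (4 * (2 * of_nat j * (2 * of_nat j - 1)))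
      \<approx> (2 * x) ^ 2 / (4 * ((2 * x + 1) * (2 * x + 2)))" .
  moreover have "reflected_term (Suc j) \<approx> (- 1) ^ n * (2 / (x ^ 2 * C m))"
    using Suc j by (simp add: C_def x_def)
  ultimately have "reflected_term j \<approx> (- 1) ^ n * (2 / (of_nat (Suc m) ^ 2 * C (Suc m)))"
    unfolding eq1 eq2 mult.assoc[symmetric, of "(- 1) ^ n"] by (intro rat_cong_mult)
  thus ?case by (simp only: C_def j)
qed

lemma sum_reflect: "(\<Sum>j=1..n. f j) = (\<Sum>m=1..n. f (n + 1 - m))"
  by (rule sum.reindex_bij_witness[where i = "\<lambda>m. n + 1 - m" and j = "\<lambda>m. n + 1 - m"]) auto

lemma reflected_sum_16:
  "(\<Sum>j=1..n. reflected_term j) \<approx> 2 * (- 1) ^ n * inv_central_sum 1"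
proof -
  have "(\<Sum>j=1..n. reflected_term j) = (\<Sum>m=1..n. reflected_term (n + 1 - m))"
    by (rule sum_reflect)
  also have "\<dots> \<approx> (\<Sum>m=1..n. (- 1) ^ n * (2 / (of_nat m ^ 2 * of_nat (2 * m choose m))))"
    by (intro rat_cong_sum reflected_term_cong) simp_all
  also have "\<dots> = 2 * (- 1) ^ n * inv_central_sum 1"
    unfolding inv_central_sum_def sum_distrib_left by (intro sum.cong refl) simp
  finally show ?thesis .
qed

text \<open>Under \<open>j = n + 1 - m\<close> the extra factor \<open>1 / 4 ^ j\<close> is
  \<open>4 ^ m / 4 ^ (n + 1)\<close>, which is \<open>4 ^ m / 4\<close> modulo
  \<open>p\<close>.\<close>

lemma reflected_sum_4:
  "(\<Sum>j=1..n. reflected_term j / 4 ^ j) \<approx> (- 1) ^ n / 2 * inv_central_sum 4"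
proof -
  have "(\<Sum>j=1..n. reflected_term j / 4 ^ j) = (\<Sum>m=1..n. reflected_term (n + 1 - m) / 4 ^ (n + 1 - m))"
    by (rule sum_reflect)
  also have "\<dots> \<approx> (\<Sum>m=1..n. (- 1) ^ n * (2 / (of_nat m ^ 2 * of_nat (2 * m choose m))) * (4 ^ m / 4))"
  proof (rule rat_cong_sum)
    fix m assume m: "m \<in> {1..n}"
    have four: "integral (1 / 4)" using integral_inverse_power_2(1)[of 1] by simp
    have "1 / 4 ^ n \<approx> 1 / 1"
      by (rule rat_cong_divide[OF rat_cong_refl four_power_n]) (simp_all add: integral_inverse_power_2)
    hence "1 / 4 ^ n * (4 ^ m / 4) \<approx> 1 / 1 * (4 ^ m / 4)"
      using integral_mult[OF _ four, of "4 ^ m"] by (intro rat_cong_mult_right) simp_all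
    moreover have "n + 1 = m + (n + 1 - m)" using m by simp
    hence "(4 :: rat) ^ (n + 1) = 4 ^ m * 4 ^ (n + 1 - m)" by (metis power_add)
    hence "1 / 4 ^ n * (4 ^ m / 4) = (1 / 4 ^ (n + 1 - m) :: rat)"
      by (simp add: field_simps)
    ultimately have "reflected_term (n + 1 - m) * (1 / 4 ^ (n + 1 - m))
       \<approx> (- 1) ^ n * (2 / (of_nat m ^ 2 * of_nat (2 * m choose m))) * (4 ^ m / 4)"
      using m by (intro rat_cong_mult reflected_term_cong) simp_all
    thus "reflected_term (n + 1 - m) / 4 ^ (n + 1 - m)
       \<approx> (- 1) ^ n * (2 / (of_nat m ^ 2 * of_nat (2 * m choose m))) * (4 ^ m / 4)" by simp
  qed
  also have "\<dots> = (- 1) ^ n / 2 * inv_central_sum 4"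
    unfolding inv_central_sum_def sum_distrib_left by (intro sum.cong refl) simp
  finally show ?thesis .
qed

section \<open>The individual congruences of the theorem\<close>

lemma lower_sum_4_cong:
  "rat_cong p 2 (\<Sum>k = 0..(p - 3) div 2. of_nat ((2 * k) choose k) / ((2 * of_nat k + 1) * 4 ^ k))
     ((- 1) ^ ((p + 1) div 2) * fermat_quotient p 2)"
proof -
  have "{0..(p - 3) div 2} = {..<n}" using n_pos by (auto simp: p_eq)
  moreover have "of_nat ((2 * k) choose k) / ((2 * of_nat k + 1) * 4 ^ k)
     = (of_nat (2 * k choose k) * (of_int 4 / 16) ^ k / (2 * of_nat k + 1) :: rat)" for k
    by (simp add: power_one_over mult_ac)
  \<comment> \<open>The numerator is \<open>(- 1) ^ n * (1 - 4 ^ n)\<close> and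
    \<open>4 ^ n = 2 ^ (p - 1)\<close>, so the quotient is a Fermat quotient up to sign.\<close>
  moreover have "(of_int (cheb 4 (Suc n) + cheb 4 n) - (- of_int 4) ^ n) / of_nat p
     = ((- 1) ^ ((p + 1) div 2) * fermat_quotient p 2 :: rat)"
  proof -
    have "cheb 4 (Suc n) + cheb 4 n = (- 1) ^ n" by (simp add: cheb_4 algebra_simps)
    moreover have "(- of_int 4) ^ n = ((- 1) ^ n * 4 ^ n :: rat)" by (simp flip: power_mult_distrib)
    moreover have "(2 :: rat) ^ (p - 1) = 4 ^ n" by (simp add: p_eq power_mult)
    moreover have "(p + 1) div 2 = Suc n" by (simp add: p_eq)
    ultimately show ?thesis unfolding fermat_quotient_def
      by (simp only: of_int_power of_int_minus of_int_1 of_int_numeral) (simp add: algebra_simps diff_divide_distrib)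
  qed
  ultimately show ?thesis using lower_sum_cong[of 4] by (simp only:)
qed

lemma lower_sum_16_cong:
  assumes "p > 3"
  shows "rat_cong p 2
     (\<Sum>k = 0..(p - 3) div 2. of_nat ((2 * k) choose k) / ((2 * of_nat k + 1) * 16 ^ k)) 0"
proof -
  have "{0..(p - 3) div 2} = {..<n}" using n_pos by (auto simp: p_eq)
  moreover have "of_nat ((2 * k) choose k) / ((2 * of_nat k + 1) * 16 ^ k)
     = (of_nat (2 * k choose k) * (of_int 1 / 16) ^ k / (2 * of_nat k + 1) :: rat)" for k
    by (simp add: power_one_over mult_ac)
  moreover have "(of_int (cheb 1 (Suc n) + cheb 1 n) - (- of_int 1) ^ n) / of_nat p = (0 :: rat)"
  proof -
    \<comment> \<open>Otherwise \<open>3\<close> would divide \<open>2 n + 1 = p\<close>. In the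
      remaining classes the closed form is exactly zero.\<close>
    have "n mod 3 \<noteq> 1" using three_not_dvd[OF assms] unfolding p_eq by presburger
    thus ?thesis by (simp add: cheb_one_Suc_add)
  qed
  ultimately show ?thesis using lower_sum_cong[of 1] by (simp only:)
qed

lemma minus_one_power_n: "(- 1) ^ n * ((- 1) ^ n * x) = (x :: rat)"
  by (simp flip: mult.assoc power_add mult_2)

lemma inv_central_sum_4_euler:
  assumes "p > 3"
  shows "(- 1) ^ n / 4 * inv_central_sum 4 \<approx> of_int (euler_number (p - 3))"
proof -
  have "integral ((- 1) ^ n / 4)"
    using integral_divide[of "(- 1) ^ n" 4] integral_inverse_power_2(1)[of 1] by simp
  moreover have "inv_central_sum 4 \<approx> 2 * (2 * (- 1) ^ n * of_int (euler_number (p - 3)))"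
    by (rule rat_cong_trans[OF inv_central_sum_4[OF assms]],
        rule rat_cong_mult_left[OF _ alternating_sum_cong_euler[OF assms]]) simp
  ultimately have "(- 1) ^ n / 4 * inv_central_sum 4
     \<approx> (- 1) ^ n / 4 * (2 * (2 * (- 1) ^ n * of_int (euler_number (p - 3))))"
    by (rule rat_cong_mult_left)
  thus ?thesis using minus_one_power_n[of "of_int (euler_number (p - 3))"]
    by (simp add: mult.assoc)
qed

lemma inv_central_sum_1_euler:
  assumes "p > 3"
  shows "(- 1) ^ n / 4 * inv_central_sum 1 \<approx> 1 / 3 * of_int (euler_number (p - 3))"
proof -
  have "integral ((- 1) ^ n / 4)"
    using integral_divide[of "(- 1) ^ n" 4] integral_inverse_power_2(1)[of 1] by simp
  moreover have "integral (2 / 3)" using integral_divide[OF _ integral_inverse_3[OF assms], of 2] by simp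
  hence "inv_central_sum 1 \<approx> 2 / 3 * (2 * (- 1) ^ n * of_int (euler_number (p - 3)))"
    by (rule rat_cong_trans[OF inv_central_sum_1[OF assms]
          rat_cong_mult_left[OF _ alternating_sum_cong_euler[OF assms]]])
  ultimately have "(- 1) ^ n / 4 * inv_central_sum 1
     \<approx> (- 1) ^ n / 4 * (2 / 3 * (2 * (- 1) ^ n * of_int (euler_number (p - 3))))"
    by (rule rat_cong_mult_left)
  thus ?thesis using minus_one_power_n[of "of_int (euler_number (p - 3))"]
    by (simp add: mult.assoc)
qed

lemma upper_sum_4_cong:
  assumes "p > 3"
  shows "rat_cong p 2
     (\<Sum>k | p < 2 * k \<and> k < p. of_nat ((2 * k) choose k) / ((2 * of_nat k + 1) * 4 ^ k))
     (of_nat p * of_int (euler_number (p - 3)))"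
proof -
  let ?E = "of_int (euler_number (p - 3)) :: rat"
  have "of_nat ((2 * k) choose k) / ((2 * of_nat k + 1) * 4 ^ k)
     = (of_nat (2 * k choose k) * (of_int 4 / 16) ^ k / (2 * of_nat k + 1) :: rat)" for k
    by (simp add: power_one_over mult_ac)
  moreover have "(- 1) ^ n * of_int 4 ^ n / 4 * inv_central_sum 4 \<approx> ?E"
    using rat_cong_mult[OF four_power_n inv_central_sum_4_euler[OF assms]] by (simp add: mult_ac)
  from rat_cong_p_mult[OF this]
  have "rat_cong p 2 (of_nat p * ((- 1) ^ n * of_int 4 ^ n / 4 * inv_central_sum 4)) (of_nat p * ?E)"
    by (simp only: numeral_2_eq_2)
  ultimately show ?thesis using rat_cong_trans[OF upper_sum_cong[of 4]] by (simp only:)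
qed

lemma upper_sum_16_cong:
  assumes "p > 3"
  shows "rat_cong p 2
     (\<Sum>k | p < 2 * k \<and> k < p. of_nat ((2 * k) choose k) / ((2 * of_nat k + 1) * 16 ^ k))
     (of_nat p / 3 * of_int (euler_number (p - 3)))"
proof -
  let ?E = "of_int (euler_number (p - 3)) :: rat"
  have "of_nat ((2 * k) choose k) / ((2 * of_nat k + 1) * 16 ^ k)
     = (of_nat (2 * k choose k) * (of_int 1 / 16) ^ k / (2 * of_nat k + 1) :: rat)" for k
    by (simp add: power_one_over mult_ac)
  moreover have "(- 1) ^ n * of_int 1 ^ n / 4 * inv_central_sum 1 \<approx> 1 / 3 * ?E"
    using inv_central_sum_1_euler[OF assms] by simp
  from rat_cong_p_mult[OF this]
  have "rat_cong p 2 (of_nat p * ((- 1) ^ n * of_int 1 ^ n / 4 * inv_central_sum 1)) (of_nat p * (1 / 3 * ?E))"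
    by (simp only: numeral_2_eq_2)
  moreover have "of_nat p * (1 / 3 * ?E) = of_nat p / 3 * ?E" by simp
  ultimately show ?thesis using rat_cong_trans[OF upper_sum_cong[of 1]] by (simp only:)
qed

text \<open>From \<open>1 / (2 k - 1) = 1 / (2 k (2 k - 1)) + 1 / (2 k)\<close> one gets a reflected
  sum and a telescoping one. The latter equals \<open>4 ^ n / (2 n choose n) - 1\<close>, giving
  \<open>(- 1) ^ n - 1\<close> modulo \<open>p\<close>.\<close>

lemma inverse_sum_4_cong:
  assumes "p > 3"
  shows "rat_cong p 1
     (\<Sum>k = 1..(p - 1) div 2. 4 ^ k / ((2 * of_nat k - 1) * of_nat ((2 * k) choose k)))
     (of_int (euler_number (p - 3)) + (- 1) ^ ((p - 1) div 2) - 1)"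
proof -
  let ?E = "of_int (euler_number (p - 3)) :: rat"
  have half: "(p - 1) div 2 = n" by (simp add: p_eq)
  have "(\<Sum>k=1..n. 4 ^ k / ((2 * of_nat k - 1) * of_nat ((2 * k) choose k)))
      = (\<Sum>k=1..n. 1 / 2 * (reflected_term k / 4 ^ k) + 1 / 2 * (4 ^ k / (of_nat k * of_nat (2 * k choose k)) :: rat))"
  proof (intro sum.cong refl)
    fix k assume k: "k \<in> {1..n}"
    have "2 * of_nat k - 1 = (of_nat (2 * k - 1) :: rat)" using k by (simp add: of_nat_diff)
    moreover have "of_nat (2 * k - 1) \<noteq> (0 :: rat)" using k unfolding of_nat_eq_0_iff by simp
    ultimately have "2 * of_nat k - 1 \<noteq> (0 :: rat)" by simp
    moreover have "of_nat k \<noteq> (0 :: rat)" "of_nat (2 * k choose k) \<noteq> (0 :: rat)" using k by simp_all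
    moreover have "a / ((2 * t - 1) * c) = 1 / 2 * (a / (t * (2 * t - 1) * c)) + 1 / 2 * (a / (t * c))"
      if "2 * t - 1 \<noteq> 0" "t \<noteq> 0" "c \<noteq> 0" for a c t :: rat
    proof -
      have "a / (t * c) = a * r / (t * r * c)" "a / (r * c) = 1 / 2 * (2 * a * t / (t * r * c))"
        if "r \<noteq> 0" for r
        using that \<open>t \<noteq> 0\<close> by simp_all
      from this[OF that(1)] show ?thesis
        by (simp only: add_divide_distrib[symmetric] distrib_left[symmetric]) (simp add: algebra_simps)
    qed
    ultimately have "4 ^ k / ((2 * of_nat k - 1) * of_nat (2 * k choose k))
      = 1 / 2 * (4 ^ k / (of_nat k * (2 * of_nat k - 1) * of_nat (2 * k choose k)))
        + 1 / 2 * (4 ^ k / (of_nat k * of_nat (2 * k choose k)) :: rat)" by blast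
    moreover have "reflected_term k / 4 ^ k = 4 ^ k / (of_nat k * (2 * of_nat k - 1) * of_nat (2 * k choose k))"
    proof -
      have "(16 :: rat) ^ k = 4 ^ k * 4 ^ k" by (simp flip: power_mult_distrib)
      thus ?thesis unfolding reflected_term_def by simp
    qed
    ultimately show "4 ^ k / ((2 * of_nat k - 1) * of_nat (2 * k choose k))
      = 1 / 2 * (reflected_term k / 4 ^ k) + 1 / 2 * (4 ^ k / (of_nat k * of_nat (2 * k choose k)) :: rat)"
      by (simp only:)
  qed
  also have "\<dots> = 1 / 2 * (\<Sum>k=1..n. reflected_term k / 4 ^ k) + (4 ^ n / of_nat (2 * n choose n) - 1)"
    unfolding sum.distrib sum_distrib_left[symmetric] sum_four_power_div_central_binomial by simp
  also have "\<dots> \<approx> 1 / 2 * ((- 1) ^ n / 2 * inv_central_sum 4) + (1 / (- 1) ^ n - 1)"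
  proof (intro rat_cong_add rat_cong_diff rat_cong_mult_left reflected_sum_4 integral_inverse_2)
    show "4 ^ n / of_nat (2 * n choose n) \<approx> 1 / (- 1) ^ n"
    proof (rule rat_cong_divide[OF four_power_n central_binomial_n])
      have "1 / (- 1) ^ n = ((- 1) ^ n :: rat)" by (cases "even n") simp_all
      thus "integral (1 / (- 1) ^ n)" by (simp only: integral_power integral_numeral)
    qed (simp_all add: integral_inverse_central_binomial)
    show "1 \<approx> 1" by (simp add: rat_cong_refl)
  qed
  also have "\<dots> = (- 1) ^ n / 4 * inv_central_sum 4 + ((- 1) ^ n - 1)"
    by (cases "even n") simp_all
  also have "\<dots> \<approx> ?E + ((- 1) ^ n - 1)"
    using assms by (intro rat_cong_add inv_central_sum_4_euler rat_cong_refl) simp_all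
  finally show ?thesis unfolding half by (simp only: One_nat_def add_diff_eq)
qed

lemma inverse_sum_16_cong:
  assumes "p > 3"
  shows "rat_cong p 1
     (\<Sum>k = 1..(p - 1) div 2. 16 ^ k / (of_nat k * (2 * of_nat k - 1) * of_nat ((2 * k) choose k)))
     (8 / 3 * of_int (euler_number (p - 3)))"
proof -
  have "(p - 1) div 2 = n" by (simp add: p_eq)
  moreover have "8 * ((- 1) ^ n / 4 * inv_central_sum 1) \<approx> 8 * (1 / 3 * of_int (euler_number (p - 3)))"
    using assms by (intro rat_cong_mult_left inv_central_sum_1_euler) simp_all
  hence "2 * (- 1) ^ n * inv_central_sum 1 \<approx> 8 / 3 * of_int (euler_number (p - 3))" by (simp add: mult_ac)
  from rat_cong_trans[OF reflected_sum_16 this]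
  have "rat_cong p 1 (\<Sum>j=1..n. reflected_term j) (8 / 3 * of_int (euler_number (p - 3)))"
    by (simp only: One_nat_def)
  ultimately show ?thesis by (simp only: reflected_term_def)
qed

end

text \<open>The reduction to inverse squares assumes \<open>p > 3\<close>, so the two congruences of
  part (i) involving an Euler number are checked directly at \<open>3\<close>.\<close>

lemma sums_4_cong_three:
  shows "rat_cong 3 2
     (\<Sum>k | 3 < 2 * k \<and> k < 3. of_nat ((2 * k) choose k) / ((2 * of_nat k + 1) * 4 ^ k))
     (of_nat 3 * of_int (euler_number (3 - 3)))"
    and "rat_cong 3 1
     (\<Sum>k = 1..(3 - 1) div 2. 4 ^ k / ((2 * of_nat k - 1) * of_nat ((2 * k) choose k)))
     (of_int (euler_number (3 - 3)) + (- 1) ^ ((3 - 1) div 2) - 1)"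
proof -
  interpret rat_cong_prime 3 by unfold_locales simp
  have "{k::nat. 3 < 2 * k \<and> k < 3} = {2}" by auto
  moreover have "(4 choose 2 :: nat) = 6" by (simp add: eval_nat_numeral)
  \<comment> \<open>The only term is \<open>6 / 80 = 3 / 40\<close>, and
    \<open>3 / 40 - 3 = 9 * (- 13 / 40)\<close>.\<close>
  moreover have "integral (- 13 / 40)"
    using integral_inverse_of_nat[of 40] integral_divide[of "- 13" 40] by simp
  hence "rat_cong 3 2 (3 / 40) 3" by (intro rat_congI[of _ "- 13 / 40"]) simp_all
  ultimately show "rat_cong 3 2
     (\<Sum>k | 3 < 2 * k \<and> k < 3. of_nat ((2 * k) choose k) / ((2 * of_nat k + 1) * 4 ^ k))
     (of_nat 3 * of_int (euler_number (3 - 3)))"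
    by (simp add: euler_number_0)
  have "rat_cong 3 1 2 (- 1)" by (rule rat_congI[of _ 1]) simp_all
  thus "rat_cong 3 1
     (\<Sum>k = 1..(3 - 1) div 2. 4 ^ k / ((2 * of_nat k - 1) * of_nat ((2 * k) choose k)))
     (of_int (euler_number (3 - 3)) + (- 1) ^ ((3 - 1) div 2) - 1)"
    by (simp add: euler_number_0)
qed

theorem theorem1p1:
  fixes p :: nat
  assumes "prime p" and "odd p"
  shows
    "rat_cong p 2
       (\<Sum>k = 0..(p - 3) div 2. of_nat ((2 * k) choose k) / ((2 * of_nat k + 1) * 4 ^ k))
       ((- 1) ^ ((p + 1) div 2) * fermat_quotient p 2)
     \<and>
     (let A = rat_cong p 2
                (\<Sum>k | p < 2 * k \<and> k < p.
                   of_nat ((2 * k) choose k) / ((2 * of_nat k + 1) * 4 ^ k))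
                (of_nat p * of_int (euler_number (p - 3)));
          B = rat_cong p 1
                (\<Sum>k = 1..(p - 1) div 2.
                   4 ^ k / ((2 * of_nat k - 1) * of_nat ((2 * k) choose k)))
                (of_int (euler_number (p - 3)) + (- 1) ^ ((p - 1) div 2) - 1)
      in A \<and> B \<and> (A \<longleftrightarrow> B))
     \<and>
     (p > 3 \<longrightarrow>
        rat_cong p 2
          (\<Sum>k = 0..(p - 3) div 2. of_nat ((2 * k) choose k) / ((2 * of_nat k + 1) * 16 ^ k))
          0
        \<and>
        (let A = rat_cong p 2
                   (\<Sum>k | p < 2 * k \<and> k < p.
                      of_nat ((2 * k) choose k) / ((2 * of_nat k + 1) * 16 ^ k))
                   (of_nat p / 3 * of_int (euler_number (p - 3)));
             B = rat_cong p 1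
                   (\<Sum>k = 1..(p - 1) div 2.
                      16 ^ k / (of_nat k * (2 * of_nat k - 1) * of_nat ((2 * k) choose k)))
                   (8 / 3 * of_int (euler_number (p - 3)))
         in A \<and> B \<and> (A \<longleftrightarrow> B)))"
proof -
  interpret rat_cong_odd_prime p "p div 2"
    using assms by unfold_locales simp_all
  have "p = 3 \<or> p > 3"
    using n_pos p_eq by linarith
  hence "rat_cong p 2
      (\<Sum>k | p < 2 * k \<and> k < p. of_nat ((2 * k) choose k) / ((2 * of_nat k + 1) * 4 ^ k))
      (of_nat p * of_int (euler_number (p - 3)))"
    and "rat_cong p 1
      (\<Sum>k = 1..(p - 1) div 2. 4 ^ k / ((2 * of_nat k - 1) * of_nat ((2 * k) choose k)))
      (of_int (euler_number (p - 3)) + (- 1) ^ ((p - 1) div 2) - 1)"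
    using upper_sum_4_cong inverse_sum_4_cong sums_4_cong_three by blast+
  thus ?thesis
    \<comment> \<open>Both sides of each stated equivalence have been proved, so the equivalences
      follow propositionally.\<close>
    unfolding Let_def
    using lower_sum_4_cong lower_sum_16_cong upper_sum_16_cong inverse_sum_16_cong by blast
qed

end
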